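(* Let $M$ be a set and let $\in_1,\in_2$ be binary relations on $M$ such that $(M,\in_1,\in_2)\models ZFC(\in_1)\cup ZFC(\in_2)$. Then $(M,\in_1)\cong(M,\in_2)$, and there is such an isomorphism which is a class function definable in $(M,\in_1,\in_2)$ by a first-order formula of the vocabulary $\{\in_1,\in_2\}$.
   Context: $ZFC(\in_1)$ denotes the first-order Zermelo–Fraenkel axioms of set theory with choice in which $\in_1$ plays the role of the membership relation, but where the formulas allowed in the axiom schemas (Separation and Replacement) may be arbitrary first-order formulas of the extended vocabulary $\{\in_1,\in_2\}$ (with parameters). $ZFC(\in_2)$ is defined symmetrically, with $\in_2$ as the membership relation and formulas again allowed to contain both $\in_1$ and $\in_2$. *)

theory Defs
  imports Main
begin

datatype mem_sym = In1 | In2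

text \<open>First-order formulas with equality over the vocabulary consisting of the two binary
  relation symbols \<^const>\<open>In1\<close> and \<^const>\<open>In2\<close>. Variables are natural numbers
  (named variables, not de Bruijn indices).\<close>

datatype fm =
    Eq nat nat
  | Mem mem_sym nat nat
  | Neg fm
  | Conj fm fm
  | Disj fm fm
  | Imp fm fm
  | Iff fm fm
  | Forall nat fm
  | Exists nat fm

primrec fv :: "fm \<Rightarrow> nat set" where
  "fv (Eq x y) = {x, y}"
| "fv (Mem s x y) = {x, y}"
| "fv (Neg p) = fv p"
| "fv (Conj p q) = fv p \<union> fv q"
| "fv (Disj p q) = fv p \<union> fv q"
| "fv (Imp p q) = fv p \<union> fv q"
| "fv (Iff p q) = fv p \<union> fv q"
| "fv (Forall x p) = fv p - {x}"
| "fv (Exists x p) = fv p - {x}"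

primrec sat :: "'a set \<Rightarrow> (mem_sym \<Rightarrow> ('a \<times> 'a) set) \<Rightarrow> (nat \<Rightarrow> 'a) \<Rightarrow> fm \<Rightarrow> bool" where
  "sat M I e (Eq x y) \<longleftrightarrow> e x = e y"
| "sat M I e (Mem s x y) \<longleftrightarrow> (e x, e y) \<in> I s"
| "sat M I e (Neg p) \<longleftrightarrow> \<not> sat M I e p"
| "sat M I e (Conj p q) \<longleftrightarrow> sat M I e p \<and> sat M I e q"
| "sat M I e (Disj p q) \<longleftrightarrow> sat M I e p \<or> sat M I e q"
| "sat M I e (Imp p q) \<longleftrightarrow> (sat M I e p \<longrightarrow> sat M I e q)"
| "sat M I e (Iff p q) \<longleftrightarrow> (sat M I e p \<longleftrightarrow> sat M I e q)"
| "sat M I e (Forall x p) \<longleftrightarrow> (\<forall>a\<in>M. sat M I (e(x := a)) p)"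
| "sat M I e (Exists x p) \<longleftrightarrow> (\<exists>a\<in>M. sat M I (e(x := a)) p)"

fun interp :: "('a \<times> 'a) set \<Rightarrow> ('a \<times> 'a) set \<Rightarrow> mem_sym \<Rightarrow> ('a \<times> 'a) set" where
  "interp E1 E2 In1 = E1"
| "interp E1 E2 In2 = E2"

text \<open>A formula with free variables is true in a structure iff its universal closure is, i.e. iff
  it is satisfied by every assignment into the universe; this is how parameters enter the axiom
  schemas below. Universes of first-order structures are nonempty.\<close>

definition models :: "'a set \<Rightarrow> ('a \<times> 'a) set \<Rightarrow> ('a \<times> 'a) set \<Rightarrow> fm set \<Rightarrow> bool" where
  "models M E1 E2 T \<longleftrightarrow> M \<noteq> {} \<and>
     (\<forall>p\<in>T. \<forall>e. range e \<subseteq> M \<longrightarrow> sat M (interp E1 E2) e p)"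

definition extensionality :: "mem_sym \<Rightarrow> fm" where
  "extensionality s =
     Forall 0 (Forall 1 (Imp (Forall 2 (Iff (Mem s 2 0) (Mem s 2 1))) (Eq 0 1)))"

definition foundation :: "mem_sym \<Rightarrow> fm" where
  "foundation s =
     Forall 0 (Imp (Exists 1 (Mem s 1 0))
       (Exists 1 (Conj (Mem s 1 0) (Neg (Exists 2 (Conj (Mem s 2 1) (Mem s 2 0)))))))"

definition pairing :: "mem_sym \<Rightarrow> fm" where
  "pairing s =
     Forall 0 (Forall 1 (Exists 2 (Forall 3 (Iff (Mem s 3 2) (Disj (Eq 3 0) (Eq 3 1))))))"

definition union :: "mem_sym \<Rightarrow> fm" where
  "union s =
     Forall 0 (Exists 1 (Forall 2
       (Iff (Mem s 2 1) (Exists 3 (Conj (Mem s 3 0) (Mem s 2 3))))))"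

definition power_set :: "mem_sym \<Rightarrow> fm" where
  "power_set s =
     Forall 0 (Exists 1 (Forall 2
       (Iff (Mem s 2 1) (Forall 3 (Imp (Mem s 3 2) (Mem s 3 0))))))"

text \<open>There is a set containing the empty set and closed under \<open>x \<mapsto> x \<union> {x}\<close>.\<close>

definition infinity :: "mem_sym \<Rightarrow> fm" where
  "infinity s =
     Exists 0 (Conj
       (Exists 1 (Conj (Mem s 1 0) (Forall 2 (Neg (Mem s 2 1)))))
       (Forall 1 (Imp (Mem s 1 0)
         (Exists 2 (Conj (Mem s 2 0)
           (Forall 3 (Iff (Mem s 3 2) (Disj (Mem s 3 1) (Eq 3 1)))))))))"

text \<open>Every set of nonempty, pairwise disjoint sets has a transversal, i.e. a set meeting each of
  its elements in exactly one point.\<close>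

definition choice :: "mem_sym \<Rightarrow> fm" where
  "choice s =
     Forall 0 (Imp
       (Conj
         (Forall 1 (Imp (Mem s 1 0) (Exists 2 (Mem s 2 1))))
         (Forall 1 (Forall 2 (Imp (Conj (Mem s 1 0) (Mem s 2 0))
           (Imp (Exists 3 (Conj (Mem s 3 1) (Mem s 3 2))) (Eq 1 2))))))
       (Exists 4 (Forall 1 (Imp (Mem s 1 0)
         (Exists 2 (Forall 3 (Iff (Conj (Mem s 3 4) (Mem s 3 1)) (Eq 3 2))))))))"

text \<open>The formula \<open>p\<close> ranges over all formulas in both membership symbols, whatever \<open>s\<close> is; its free
  variables other than the designated ones are parameters. The set \<open>a\<close> may occur free in \<open>p\<close>.\<close>

definition separation :: "mem_sym \<Rightarrow> fm set" where
  "separation s =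
     {Forall a (Exists b (Forall x (Iff (Mem s x b) (Conj (Mem s x a) p)))) |a b x p.
        distinct [a, b, x] \<and> b \<notin> fv p}"

text \<open>If for each \<open>x\<close> in \<open>a\<close> there is at most one \<open>y\<close> with \<open>p\<close>, then these \<open>y\<close> form a set.\<close>

definition replacement :: "mem_sym \<Rightarrow> fm set" where
  "replacement s =
     {Forall a (Imp
        (Forall x (Imp (Mem s x a) (Exists z (Forall y (Imp p (Eq y z))))))
        (Exists b (Forall y (Iff (Mem s y b) (Exists x (Conj (Mem s x a) p)))))) |a b x y z p.
        distinct [a, b, x, y, z] \<and> b \<notin> fv p \<and> z \<notin> fv p}"

definition ZFC :: "mem_sym \<Rightarrow> fm set" where
  "ZFC s =
     {extensionality s, foundation s, pairing s, union s, power_set s, infinity s, choice s}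
     \<union> separation s \<union> replacement s"

definition is_isomorphism ::
    "'a set \<Rightarrow> ('a \<times> 'a) set \<Rightarrow> 'b set \<Rightarrow> ('b \<times> 'b) set \<Rightarrow> ('a \<Rightarrow> 'b) \<Rightarrow> bool" where
  "is_isomorphism M E N F f \<longleftrightarrow>
     bij_betw f M N \<and> (\<forall>x\<in>M. \<forall>y\<in>M. (x, y) \<in> E \<longleftrightarrow> (f x, f y) \<in> F)"

text \<open>The graph of \<open>f\<close> on the universe is defined, without parameters, by a formula whose only free
  variables are 0 (argument) and 1 (value).\<close>

definition definable_function ::
    "'a set \<Rightarrow> ('a \<times> 'a) set \<Rightarrow> ('a \<times> 'a) set \<Rightarrow> ('a \<Rightarrow> 'a) \<Rightarrow> bool" where
  "definable_function M E1 E2 f \<longleftrightarrow> f ` M \<subseteq> M \<and>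
     (\<exists>p. fv p \<subseteq> {0, 1} \<and>
       (\<forall>e. range e \<subseteq> M \<longrightarrow> (sat M (interp E1 E2) e p \<longleftrightarrow> f (e 0) = e 1)))"

end

theory Submission
  imports Defs
begin

text \<open>
  No ordinals are needed. For membership relations \<open>s\<close> and \<open>t\<close>, recursion on \<open>s\<close> gives
  \<open>lev s t x\<close>, the \<open>t\<close>-set of all \<open>w\<close> that are \<open>t\<close>-subsets of \<open>lev s t z\<close> for some \<open>z\<close> in \<open>x\<close>: the
  stage of the cumulative hierarchy of \<open>t\<close> whose index is the \<open>s\<close>-rank of \<open>x\<close>. If this stage failed
  to be a \<open>t\<close>-set for a minimal \<open>x\<close>, it would, by comparison with the stages \<open>lev t t y\<close>, be the whole
  universe; but it is an \<open>s\<close>-set, contradicting Russell. So \<open>t\<close> is at least as tall as \<open>s\<close>, and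
  replacement for \<open>t\<close> along \<open>lev s t x\<close> makes every stage of the hierarchy of \<open>s\<close>, hence every
  \<open>s\<close>-set, coextensive with a \<open>t\<close>-set. By symmetry both relations have the same sets of elements, and
  the recursion \<open>F x = {F z | z \<in> x}\<close>, evaluated from \<open>s\<close> to \<open>t\<close>, is the isomorphism; its inverse is
  the same recursion from \<open>t\<close> to \<open>s\<close>.
\<close>

subsection \<open>Definability\<close>

lemma finite_fv: "finite (fv p)"
  by (induction p) auto

lemma sat_cong: "(\<And>x. x \<in> fv p \<Longrightarrow> e x = e' x) \<Longrightarrow> sat M I e p = sat M I e' p"
proof (induction p arbitrary: e e')
  case (Forall x p)
  have "sat M I (e(x := a)) p = sat M I (e'(x := a)) p" for a
    by (rule Forall.IH) (use Forall.prems in auto)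
  then show ?case by simp
next
  case (Exists x p)
  have "sat M I (e(x := a)) p = sat M I (e'(x := a)) p" for a
    by (rule Exists.IH) (use Exists.prems in auto)
  then show ?case by simp
next
  case (Neg p)
  have "sat M I e p = sat M I e' p" by (rule Neg.IH) (use Neg.prems in auto)
  then show ?case by simp
next
  case (Conj p q)
  have "sat M I e p = sat M I e' p" by (rule Conj.IH(1)) (use Conj.prems in auto)
  moreover have "sat M I e q = sat M I e' q" by (rule Conj.IH(2)) (use Conj.prems in auto)
  ultimately show ?case by simp
next
  case (Disj p q)
  have "sat M I e p = sat M I e' p" by (rule Disj.IH(1)) (use Disj.prems in auto)
  moreover have "sat M I e q = sat M I e' q" by (rule Disj.IH(2)) (use Disj.prems in auto)
  ultimately show ?case by simp
next
  case (Imp p q)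
  have "sat M I e p = sat M I e' p" by (rule Imp.IH(1)) (use Imp.prems in auto)
  moreover have "sat M I e q = sat M I e' q" by (rule Imp.IH(2)) (use Imp.prems in auto)
  ultimately show ?case by simp
next
  case (Iff p q)
  have "sat M I e p = sat M I e' p" by (rule Iff.IH(1)) (use Iff.prems in auto)
  moreover have "sat M I e q = sat M I e' q" by (rule Iff.IH(2)) (use Iff.prems in auto)
  ultimately show ?case by simp
qed simp_all

text \<open>The new bound variable \<open>y\<close> is taken outside the finite set of images of the
  other free variables, so that none of them is captured.\<close>

lemma ex_fresh_update:
  fixes \<sigma> :: "nat \<Rightarrow> nat"
  obtains y where "\<sigma>(x := y) ` fv p - {y} \<subseteq> \<sigma> ` (fv p - {x})"
    and "\<And>e a. sat M I (e(y := a) \<circ> \<sigma>(x := y)) p = sat M I ((e \<circ> \<sigma>)(x := a)) p"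
proof -
  have "finite (\<sigma> ` (fv p - {x}))" by (simp add: finite_fv)
  from ex_new_if_finite[OF infinite_UNIV_nat this]
  obtain y where y: "y \<notin> \<sigma> ` (fv p - {x})" by blast
  show thesis
  proof
    show "\<sigma>(x := y) ` fv p - {y} \<subseteq> \<sigma> ` (fv p - {x})" by auto
    show "sat M I (e(y := a) \<circ> \<sigma>(x := y)) p = sat M I ((e \<circ> \<sigma>)(x := a)) p" for e a
      by (rule sat_cong) (use y in auto)
  qed
qed

text \<open>Since \<open>\<sigma>\<close> need not be injective, this serves both to make room for
  new variables and to merge several variables into one. It is generalised in the induction because
  each quantifier updates it.\<close>

lemma ex_rename:
  "\<exists>p'. fv p' \<subseteq> \<sigma> ` fv p \<and> (\<forall>e. sat M I e p' = sat M I (e \<circ> \<sigma>) p)"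
proof (induction p arbitrary: \<sigma>)
  case (Eq x y)
  show ?case by (rule exI[of _ "Eq (\<sigma> x) (\<sigma> y)"]) simp
next
  case (Mem s x y)
  show ?case by (rule exI[of _ "Mem s (\<sigma> x) (\<sigma> y)"]) simp
next
  case (Neg p)
  then obtain p' where "fv p' \<subseteq> \<sigma> ` fv p" "\<forall>e. sat M I e p' = sat M I (e \<circ> \<sigma>) p" by blast
  then show ?case by (intro exI[of _ "Neg p'"]) (simp add: comp_def)
next
  case (Conj p q)
  obtain p' where "fv p' \<subseteq> \<sigma> ` fv p" "\<forall>e. sat M I e p' = sat M I (e \<circ> \<sigma>) p"
    using Conj.IH(1) by blast
  moreover obtain q' where "fv q' \<subseteq> \<sigma> ` fv q" "\<forall>e. sat M I e q' = sat M I (e \<circ> \<sigma>) q"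
    using Conj.IH(2) by blast
  ultimately show ?case by (intro exI[of _ "Conj p' q'"]) (auto simp: comp_def)
next
  case (Disj p q)
  obtain p' where "fv p' \<subseteq> \<sigma> ` fv p" "\<forall>e. sat M I e p' = sat M I (e \<circ> \<sigma>) p"
    using Disj.IH(1) by blast
  moreover obtain q' where "fv q' \<subseteq> \<sigma> ` fv q" "\<forall>e. sat M I e q' = sat M I (e \<circ> \<sigma>) q"
    using Disj.IH(2) by blast
  ultimately show ?case by (intro exI[of _ "Disj p' q'"]) (auto simp: comp_def)
next
  case (Imp p q)
  obtain p' where "fv p' \<subseteq> \<sigma> ` fv p" "\<forall>e. sat M I e p' = sat M I (e \<circ> \<sigma>) p"
    using Imp.IH(1) by blast
  moreover obtain q' where "fv q' \<subseteq> \<sigma> ` fv q" "\<forall>e. sat M I e q' = sat M I (e \<circ> \<sigma>) q"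
    using Imp.IH(2) by blast
  ultimately show ?case by (intro exI[of _ "Imp p' q'"]) (auto simp: comp_def)
next
  case (Iff p q)
  obtain p' where "fv p' \<subseteq> \<sigma> ` fv p" "\<forall>e. sat M I e p' = sat M I (e \<circ> \<sigma>) p"
    using Iff.IH(1) by blast
  moreover obtain q' where "fv q' \<subseteq> \<sigma> ` fv q" "\<forall>e. sat M I e q' = sat M I (e \<circ> \<sigma>) q"
    using Iff.IH(2) by blast
  ultimately show ?case by (intro exI[of _ "Iff p' q'"]) (auto simp: comp_def)
next
  case (Forall x p)
  obtain y where y: "\<sigma>(x := y) ` fv p - {y} \<subseteq> \<sigma> ` (fv p - {x})"
    "\<And>e a. sat M I (e(y := a) \<circ> \<sigma>(x := y)) p = sat M I ((e \<circ> \<sigma>)(x := a)) p"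
    by (rule ex_fresh_update[where \<sigma> = \<sigma> and x = x and p = p and M = M and I = I]) (rule that)
  obtain p' where "fv p' \<subseteq> \<sigma>(x := y) ` fv p" "\<forall>e. sat M I e p' = sat M I (e \<circ> \<sigma>(x := y)) p"
    using Forall by blast
  with y show ?case by (intro exI[of _ "Forall y p'"]) (auto simp: comp_def simp del: fun_upd_apply)
next
  case (Exists x p)
  obtain y where y: "\<sigma>(x := y) ` fv p - {y} \<subseteq> \<sigma> ` (fv p - {x})"
    "\<And>e a. sat M I (e(y := a) \<circ> \<sigma>(x := y)) p = sat M I ((e \<circ> \<sigma>)(x := a)) p"
    by (rule ex_fresh_update[where \<sigma> = \<sigma> and x = x and p = p and M = M and I = I]) (rule that)
  obtain p' where "fv p' \<subseteq> \<sigma>(x := y) ` fv p" "\<forall>e. sat M I e p' = sat M I (e \<circ> \<sigma>(x := y)) p"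
    using Exists by blast
  with y show ?case by (intro exI[of _ "Exists y p'"]) (auto simp: comp_def simp del: fun_upd_apply)
qed

text \<open>\<open>Inl k\<close> refers to the argument \<open>k\<close> of a predicate, \<open>Inr c\<close> to the parameter \<open>c\<close>.\<close>

definition env :: "(nat \<Rightarrow> nat + 'a) \<Rightarrow> (nat \<Rightarrow> 'a) \<Rightarrow> nat \<Rightarrow> 'a" where
  "env \<rho> e n = (case \<rho> n of Inl k \<Rightarrow> e k | Inr c \<Rightarrow> c)"

named_theorems dfn

text \<open>Indexing the two relations by \<open>mem_sym\<close> lets each lemma be proved once for
  arbitrary \<open>s\<close> and \<open>t\<close>; it then applies in both directions and also to a
  single relation.\<close>

locale bi_zf =
  fixes M :: "'a set" and I :: "mem_sym \<Rightarrow> ('a \<times> 'a) set"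
  assumes nonempty: "M \<noteq> {}"
    and mem_subset: "I s \<subseteq> M \<times> M"
    and zfc: "p \<in> ZFC s \<Longrightarrow> range e \<subseteq> M \<Longrightarrow> sat M I e p"
begin

text \<open>Predicates and terms take an assignment as argument and are definable with parameters from
  \<open>C\<close>. The value of a term is compared with variable 0, the remaining variables being shifted by one;
  the same shift accounts for bound variables in the rules \<open>dfn\<close>.\<close>

definition Dfn :: "'a set \<Rightarrow> ((nat \<Rightarrow> 'a) \<Rightarrow> bool) \<Rightarrow> bool" where
  "Dfn C R \<longleftrightarrow> (\<exists>p \<rho>. (\<forall>n c. \<rho> n = Inr c \<longrightarrow> c \<in> C) \<and>
     (\<forall>e. range e \<subseteq> M \<longrightarrow> sat M I (env \<rho> e) p = R e))"

definition Trm :: "'a set \<Rightarrow> ((nat \<Rightarrow> 'a) \<Rightarrow> 'a) \<Rightarrow> bool" where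
  "Trm C t \<longleftrightarrow> (\<forall>e. range e \<subseteq> M \<longrightarrow> t e \<in> M) \<and> Dfn C (\<lambda>e. t (\<lambda>n. e (Suc n)) = e 0)"

definition els :: "mem_sym \<Rightarrow> 'a \<Rightarrow> 'a set" where
  "els s b = {x. (x, b) \<in> I s}"

text \<open>Subsets of \<open>M\<close> are the common ground of the two relations: one and the same
  \<open>A\<close> can be tested for being a set of \<open>s\<close> and for being a set of
  \<open>t\<close>.\<close>

definition small :: "mem_sym \<Rightarrow> 'a set \<Rightarrow> bool" where
  "small s A \<longleftrightarrow> (\<exists>b\<in>M. els s b = A)"

definition code :: "mem_sym \<Rightarrow> 'a set \<Rightarrow> 'a" where
  "code s A = (SOME b. b \<in> M \<and> els s b = A)"

lemma Dfn_cong: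
  assumes "\<And>e. range e \<subseteq> M \<Longrightarrow> R e = R' e" and "Dfn C R'"
  shows "Dfn C R"
  using assms by (simp add: Dfn_def)

section \<open>Closure of definability under logical operations\<close>

lemma Dfn_Neg [dfn]: "Dfn C R \<Longrightarrow> Dfn C (\<lambda>e. \<not> R e)"
proof -
  assume "Dfn C R"
  then obtain p \<rho> where "\<forall>n c. \<rho> n = Inr c \<longrightarrow> c \<in> C"
    "\<And>e. range e \<subseteq> M \<Longrightarrow> sat M I (env \<rho> e) p = R e"
    unfolding Dfn_def by blast
  then show ?thesis
    unfolding Dfn_def by (intro exI[of _ "Neg p"] exI[of _ \<rho>]) simp
qed

text \<open>The two formulas may use one variable for different arguments or parameters. Moving one
  formula to the even variables and the other to the odd ones lets a single \<open>\<rho>\<close>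
  serve both.\<close>

lemma Dfn_join:
  assumes "Dfn C R" and "Dfn C S"
  obtains p q \<rho> where "\<forall>n c. \<rho> n = Inr c \<longrightarrow> c \<in> C"
    and "\<And>e. range e \<subseteq> M \<Longrightarrow> sat M I (env \<rho> e) p = R e"
    and "\<And>e. range e \<subseteq> M \<Longrightarrow> sat M I (env \<rho> e) q = S e"
proof -
  obtain p \<rho>1 where p: "\<forall>n c. \<rho>1 n = Inr c \<longrightarrow> c \<in> C"
    "\<forall>e. range e \<subseteq> M \<longrightarrow> sat M I (env \<rho>1 e) p = R e"
    using assms(1) unfolding Dfn_def by blast
  obtain q \<rho>2 where q: "\<forall>n c. \<rho>2 n = Inr c \<longrightarrow> c \<in> C"
    "\<forall>e. range e \<subseteq> M \<longrightarrow> sat M I (env \<rho>2 e) q = S e"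
    using assms(2) unfolding Dfn_def by blast
  define \<rho> where "\<rho> n = (if even n then \<rho>1 (n div 2) else \<rho>2 (n div 2))" for n
  obtain p' where p': "\<forall>e. sat M I e p' = sat M I (e \<circ> (\<lambda>n. 2 * n)) p"
    using ex_rename by blast
  obtain q' where q': "\<forall>e. sat M I e q' = sat M I (e \<circ> (\<lambda>n. Suc (2 * n))) q"
    using ex_rename by blast
  have 1: "env \<rho> e \<circ> (\<lambda>n. 2 * n) = env \<rho>1 e" "env \<rho> e \<circ> (\<lambda>n. Suc (2 * n)) = env \<rho>2 e" for e
    by (auto simp: env_def \<rho>_def)
  show thesis
  proof
    show "\<forall>n c. \<rho> n = Inr c \<longrightarrow> c \<in> C" using p(1) q(1) by (simp add: \<rho>_def)
    show "sat M I (env \<rho> e) p' = R e" if "range e \<subseteq> M" for e using that p(2) p' 1 by simp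
    show "sat M I (env \<rho> e) q' = S e" if "range e \<subseteq> M" for e using that q(2) q' 1 by simp
  qed
qed

lemma Dfn_Conj [dfn]:
  assumes "Dfn C R" and "Dfn C S" shows "Dfn C (\<lambda>e. R e \<and> S e)"
proof -
  obtain p q \<rho> where "\<forall>n c. \<rho> n = Inr c \<longrightarrow> c \<in> C"
    "\<And>e. range e \<subseteq> M \<Longrightarrow> sat M I (env \<rho> e) p = R e"
    "\<And>e. range e \<subseteq> M \<Longrightarrow> sat M I (env \<rho> e) q = S e"
    by (rule Dfn_join[OF assms]) blast
  then show ?thesis
    unfolding Dfn_def by (intro exI[of _ "Conj p q"] exI[of _ \<rho>]) simp
qed

lemma Dfn_Disj [dfn]:
  assumes "Dfn C R" and "Dfn C S" shows "Dfn C (\<lambda>e. R e \<or> S e)"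
proof -
  obtain p q \<rho> where "\<forall>n c. \<rho> n = Inr c \<longrightarrow> c \<in> C"
    "\<And>e. range e \<subseteq> M \<Longrightarrow> sat M I (env \<rho> e) p = R e"
    "\<And>e. range e \<subseteq> M \<Longrightarrow> sat M I (env \<rho> e) q = S e"
    by (rule Dfn_join[OF assms]) blast
  then show ?thesis
    unfolding Dfn_def by (intro exI[of _ "Disj p q"] exI[of _ \<rho>]) simp
qed

lemma Dfn_Imp [dfn]:
  assumes "Dfn C R" and "Dfn C S" shows "Dfn C (\<lambda>e. R e \<longrightarrow> S e)"
proof -
  obtain p q \<rho> where "\<forall>n c. \<rho> n = Inr c \<longrightarrow> c \<in> C"
    "\<And>e. range e \<subseteq> M \<Longrightarrow> sat M I (env \<rho> e) p = R e"
    "\<And>e. range e \<subseteq> M \<Longrightarrow> sat M I (env \<rho> e) q = S e"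
    by (rule Dfn_join[OF assms]) blast
  then show ?thesis
    unfolding Dfn_def by (intro exI[of _ "Imp p q"] exI[of _ \<rho>]) simp
qed

lemma Dfn_Iff [dfn]:
  assumes "Dfn C R" and "Dfn C S" shows "Dfn C (\<lambda>e. R e \<longleftrightarrow> S e)"
proof -
  obtain p q \<rho> where "\<forall>n c. \<rho> n = Inr c \<longrightarrow> c \<in> C"
    "\<And>e. range e \<subseteq> M \<Longrightarrow> sat M I (env \<rho> e) p = R e"
    "\<And>e. range e \<subseteq> M \<Longrightarrow> sat M I (env \<rho> e) q = S e"
    by (rule Dfn_join[OF assms]) blast
  then show ?thesis
    unfolding Dfn_def by (intro exI[of _ "Iff p q"] exI[of _ \<rho>]) simp
qed

lemma Dfn_Bex [dfn]:
  assumes "Dfn C (\<lambda>e. P (e 0) (\<lambda>n. e (Suc n)))"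
  shows "Dfn C (\<lambda>e. \<exists>a\<in>M. P a e)"
proof -
  obtain p \<rho> where p: "\<forall>n c. \<rho> n = Inr c \<longrightarrow> c \<in> C"
    "\<And>e. range e \<subseteq> M \<Longrightarrow> sat M I (env \<rho> e) p = P (e 0) (\<lambda>n. e (Suc n))"
    using assms unfolding Dfn_def by blast
  \<comment> \<open>Variables standing for argument 0 are merged into the bound variable 0, the
    others move up by one. Binding removes argument 0, so \<open>\<rho>'\<close> lowers the
    remaining argument numbers; its value at 0 is overwritten by the quantifier.\<close>
  define \<sigma> where "\<sigma> n = (if \<rho> n = Inl 0 then 0 else Suc n)" for n
  define \<rho>' where "\<rho>' n = (case n of 0 \<Rightarrow> Inl 0 | Suc m \<Rightarrow>
    (case \<rho> m of Inl k \<Rightarrow> Inl (k - 1) | Inr c \<Rightarrow> Inr c))" for n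
  obtain p' where p': "\<And>e. sat M I e p' = sat M I (e \<circ> \<sigma>) p"
    using ex_rename by blast
  have 1: "(env \<rho>' e)(0 := a) \<circ> \<sigma> = env \<rho> (case_nat a e)" for a e
    by (rule ext) (auto simp: env_def \<sigma>_def \<rho>'_def split: sum.split nat.split)
  have "sat M I (env \<rho>' e) (Exists 0 p') \<longleftrightarrow> (\<exists>a\<in>M. P a e)" if e: "range e \<subseteq> M" for e
  proof -
    have "sat M I ((env \<rho>' e)(0 := a)) p' \<longleftrightarrow> P a e" if a: "a \<in> M" for a
    proof -
      have "range (case_nat a e) \<subseteq> M" using a e by (auto simp: image_subset_iff split: nat.split)
      from p(2)[OF this] show ?thesis by (simp add: p' 1)
    qed
    then show ?thesis by simp
  qed
  moreover have "\<forall>n c. \<rho>' n = Inr c \<longrightarrow> c \<in> C"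
    using p(1) by (auto simp: \<rho>'_def split: nat.splits sum.splits)
  ultimately show ?thesis unfolding Dfn_def by blast
qed

lemma Dfn_Ball [dfn]:
  assumes "Dfn C (\<lambda>e. P (e 0) (\<lambda>n. e (Suc n)))"
  shows "Dfn C (\<lambda>e. \<forall>a\<in>M. P a e)"
proof -
  have "Dfn C (\<lambda>e. \<not> (\<exists>a\<in>M. \<not> P a e))"
    by (intro Dfn_Neg Dfn_Bex assms)
  then show ?thesis by simp
qed

lemma Dfn_rename:
  assumes "Dfn C R" shows "Dfn C (\<lambda>e. R (\<lambda>n. e (\<sigma> n)))"
proof -
  obtain p \<rho> where p: "\<forall>n c. \<rho> n = Inr c \<longrightarrow> c \<in> C"
    "\<And>e. range e \<subseteq> M \<Longrightarrow> sat M I (env \<rho> e) p = R e"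
    using assms unfolding Dfn_def by blast
  define \<rho>' where "\<rho>' n = (case \<rho> n of Inl k \<Rightarrow> Inl (\<sigma> k) | Inr c \<Rightarrow> Inr c)" for n
  have 1: "env \<rho>' e = env \<rho> (\<lambda>n. e (\<sigma> n))" for e
    by (rule ext) (auto simp: env_def \<rho>'_def split: sum.split)
  have "sat M I (env \<rho>' e) p = R (\<lambda>n. e (\<sigma> n))" if "range e \<subseteq> M" for e
    using that p(2)[of "\<lambda>n. e (\<sigma> n)"] by (auto simp: 1)
  moreover have "\<forall>n c. \<rho>' n = Inr c \<longrightarrow> c \<in> C"
    using p(1) by (auto simp: \<rho>'_def split: sum.splits)
  ultimately show ?thesis unfolding Dfn_def by blast
qed

lemma Dfn_atom: "Dfn C (\<lambda>e. e i = e j)" "Dfn C (\<lambda>e. (e i, e j) \<in> I s)"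
  unfolding Dfn_def
   apply (intro exI[of _ "Eq i j"] exI[of _ Inl], simp add: env_def)
  apply (intro exI[of _ "Mem s i j"] exI[of _ Inl], simp add: env_def)
  done

section \<open>Definable terms and their substitution\<close>

lemma Trm_var [dfn]: "Trm C (\<lambda>e. e i)"
  unfolding Trm_def by (auto intro: Dfn_atom)

lemma Trm_const [dfn]:
  assumes "c \<in> M" shows "Trm M (\<lambda>e. c)"
proof -
  have "Dfn M (\<lambda>e. c = e 0)"
    unfolding Dfn_def
    by (intro exI[of _ "Eq 0 1"] exI[of _ "\<lambda>n. if n = 0 then Inr c else Inl 0"])
      (simp add: env_def assms)
  then show ?thesis by (simp add: Trm_def assms)
qed

text \<open>The term is eliminated by a quantifier over an element \<open>a\<close> of
  \<open>M\<close> equal to its value.\<close>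

lemma Dfn_subst:
  assumes t: "Trm C t" and P: "Dfn C (\<lambda>e. P (e 0) (\<lambda>n. e (Suc n)))"
  shows "Dfn C (\<lambda>e. P (t e) e)"
proof (rule Dfn_cong)
  show "Dfn C (\<lambda>e. \<exists>a\<in>M. t e = a \<and> P a e)"
    by (intro Dfn_Bex Dfn_Conj P) (use t in \<open>simp add: Trm_def\<close>)
  show "P (t e) e = (\<exists>a\<in>M. t e = a \<and> P a e)" if "range e \<subseteq> M" for e
    using t that by (auto simp: Trm_def)
qed

lemma Trm_shift: "Trm C t \<Longrightarrow> Trm C (\<lambda>e. t (\<lambda>n. e (Suc n)))"
  unfolding Trm_def
proof (intro conjI allI impI; elim conjE)
  assume "Dfn C (\<lambda>e. t (\<lambda>n. e (Suc n)) = e 0)"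
  from Dfn_rename[OF this, of "case_nat 0 (\<lambda>n. Suc (Suc n))"]
  show "Dfn C (\<lambda>e. t (\<lambda>n. e (Suc (Suc n))) = e 0)" by simp
qed (auto simp: image_subset_iff)

lemma Dfn_subst2:
  assumes t: "Trm C t" and u: "Trm C u" and P: "Dfn C (\<lambda>e. P (e 1) (e 0))"
  shows "Dfn C (\<lambda>e. P (t e) (u e))"
proof (rule Dfn_subst[OF t])
  show "Dfn C (\<lambda>e. P (e 0) (u (\<lambda>n. e (Suc n))))"
    by (rule Dfn_subst[OF Trm_shift[OF u]])
      (use Dfn_rename[OF P, of "\<lambda>n. n"] in simp)
qed

lemma Dfn_eq [dfn]: "Trm C t \<Longrightarrow> Trm C u \<Longrightarrow> Dfn C (\<lambda>e. t e = u e)"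
  by (erule (1) Dfn_subst2[where P = "(=)"]) (rule Dfn_atom)

lemma Dfn_mem: "Trm C t \<Longrightarrow> Trm C u \<Longrightarrow> Dfn C (\<lambda>e. (t e, u e) \<in> I s)"
  by (erule (1) Dfn_subst2[where P = "\<lambda>x y. (x, y) \<in> I s"]) (rule Dfn_atom)

lemma Dfn_els [dfn]: "Trm C t \<Longrightarrow> Trm C u \<Longrightarrow> Dfn C (\<lambda>e. t e \<in> els s (u e))"
  unfolding els_def by (simp add: Dfn_mem)

lemma els_subset: "els s b \<subseteq> M"
  using mem_subset[of s] by (auto simp: els_def)

lemma els_M [simp]: "x \<in> els s b \<Longrightarrow> x \<in> M"
  using els_subset by blast

lemma Dfn_Bex_els [dfn]:
  assumes "Trm C t" and "Dfn C (\<lambda>e. P (e 0) (\<lambda>n. e (Suc n)))"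
  shows "Dfn C (\<lambda>e. \<exists>a\<in>els s (t e). P a e)"
proof (rule Dfn_cong)
  show "Dfn C (\<lambda>e. \<exists>a\<in>M. a \<in> els s (t e) \<and> P a e)"
    by (intro dfn Trm_shift assms)
qed (use els_M in blast)

lemma Dfn_Ball_els [dfn]:
  assumes "Trm C t" and "Dfn C (\<lambda>e. P (e 0) (\<lambda>n. e (Suc n)))"
  shows "Dfn C (\<lambda>e. \<forall>a\<in>els s (t e). P a e)"
proof (rule Dfn_cong)
  show "Dfn C (\<lambda>e. \<forall>a\<in>M. a \<in> els s (t e) \<longrightarrow> P a e)"
    by (intro dfn Trm_shift assms)
qed (use els_M in blast)

lemma Dfn_els_subset [dfn]:
  assumes "Trm C t" and "Trm C u"
  shows "Dfn C (\<lambda>e. els s (t e) \<subseteq> els s' (u e))"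
  unfolding subset_iff Ball_def[symmetric] by (intro dfn Trm_shift assms)

lemma Dfn_els_eq [dfn]:
  assumes "Trm C t" and "Trm C u"
  shows "Dfn C (\<lambda>e. els s (t e) = els s' (u e))"
  unfolding set_eq_subset by (intro dfn assms)

lemma Dfn_els_Collect [dfn]:
  assumes "Trm C t" and "Dfn C (\<lambda>e. P (e 0) (\<lambda>n. e (Suc n)))"
  shows "Dfn C (\<lambda>e. els s (t e) = {a \<in> M. P a e})"
proof (rule Dfn_cong)
  show "Dfn C (\<lambda>e. \<forall>a\<in>M. a \<in> els s (t e) \<longleftrightarrow> P a e)"
    by (intro dfn Trm_shift assms)
qed (use els_M in blast)

lemma Dfn_small_Collect [dfn]:
  assumes "Dfn C (\<lambda>e. P (e 0) (\<lambda>n. e (Suc n)))"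
  shows "Dfn C (\<lambda>e. small s {a \<in> M. P a e})"
  unfolding small_def
  apply (intro dfn)
  \<comment> \<open>The quantified code occupies place 1, between the element at 0 and the original
    arguments, which therefore sit two places higher.\<close>
  using Dfn_rename[OF assms, of "case_nat 0 (\<lambda>n. Suc (Suc n))"] by simp

lemma Dfn_small_els [dfn]:
  assumes "Trm C t"
  shows "Dfn C (\<lambda>e. small s (els s' (t e)))"
  unfolding small_def by (intro dfn Trm_shift assms)

subsection \<open>Consequences of the axioms\<close>

lemma smallI: "b \<in> M \<Longrightarrow> (\<And>x. x \<in> M \<Longrightarrow> (x, b) \<in> I s \<longleftrightarrow> x \<in> A) \<Longrightarrow> A \<subseteq> M \<Longrightarrow> small s A"
  unfolding small_def els_def using mem_subset[of s] by blast

lemma small_els [simp]: "b \<in> M \<Longrightarrow> small s (els s b)"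
  by (auto simp: small_def)

lemma small_subset_M: "small s A \<Longrightarrow> A \<subseteq> M"
  using els_subset by (auto simp: small_def)

lemma els_inj:
  assumes "x \<in> M" "y \<in> M" "els s x = els s y"
  shows "x = y"
proof -
  have "sat M I (\<lambda>_. x) (extensionality s)"
    by (rule zfc[of _ s]) (use assms in \<open>auto simp: ZFC_def\<close>)
  moreover have "(z, x) \<in> I s \<longleftrightarrow> (z, y) \<in> I s" for z
    using assms(3) by (auto simp: els_def)
  ultimately show ?thesis using assms by (simp add: extensionality_def)
qed

lemma code:
  assumes "small s A"
  shows code_M: "code s A \<in> M" and els_code: "els s (code s A) = A"
  using someI_ex[of "\<lambda>b. b \<in> M \<and> els s b = A"] assms
  unfolding small_def code_def by blast+

lemma eq_code_iff: "small s A \<Longrightarrow> v \<in> M \<Longrightarrow> v = code s A \<longleftrightarrow> els s v = A"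
  using els_inj code_M els_code by metis

lemma small_pair:
  assumes "x \<in> M" "y \<in> M" shows "small s {x, y}"
proof -
  have "sat M I (\<lambda>_. x) (pairing s)"
    by (rule zfc[of _ s]) (use assms in \<open>auto simp: ZFC_def\<close>)
  then obtain b where "b \<in> M" "\<forall>z\<in>M. (z, b) \<in> I s \<longleftrightarrow> z = x \<or> z = y"
    using assms by (simp add: pairing_def) blast
  then show ?thesis using assms by (intro smallI) auto
qed

lemma small_Union:
  assumes "a \<in> M" shows "small s (\<Union>x\<in>els s a. els s x)"
proof -
  have "sat M I (\<lambda>_. a) (union s)"
    by (rule zfc[of _ s]) (use assms in \<open>auto simp: ZFC_def\<close>)
  then obtain b where "b \<in> M" "\<forall>z\<in>M. (z, b) \<in> I s \<longleftrightarrow> (\<exists>x\<in>M. (x, a) \<in> I s \<and> (z, x) \<in> I s)"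
    using assms by (simp add: union_def) blast
  then show ?thesis using mem_subset[of s] by (intro smallI) (auto simp: els_def)
qed

lemma small_Pow:
  assumes "a \<in> M" shows "small s {w \<in> M. els s w \<subseteq> els s a}"
proof -
  have "sat M I (\<lambda>_. a) (power_set s)"
    by (rule zfc[of _ s]) (use assms in \<open>auto simp: ZFC_def\<close>)
  then obtain b where "b \<in> M" "\<forall>w\<in>M. (w, b) \<in> I s \<longleftrightarrow> (\<forall>x\<in>M. (x, w) \<in> I s \<longrightarrow> (x, a) \<in> I s)"
    using assms by (simp add: power_set_def) blast
  then show ?thesis using mem_subset[of s] by (intro smallI) (auto simp: els_def)
qed

lemma foundation:
  assumes "small s A" "A \<noteq> {}"
  obtains x where "x \<in> A" "els s x \<inter> A = {}"
proof -
  obtain a where a: "a \<in> M" "els s a = A" using assms(1) by (auto simp: small_def)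
  have "sat M I (\<lambda>_. a) (Defs.foundation s)"
    by (rule zfc[of _ s]) (use a in \<open>auto simp: ZFC_def\<close>)
  moreover obtain y where "y \<in> M" "(y, a) \<in> I s"
    using assms(2) a els_M by (auto simp: els_def)
  ultimately obtain x where "x \<in> M" "(x, a) \<in> I s" "\<not> (\<exists>z\<in>M. (z, x) \<in> I s \<and> (z, a) \<in> I s)"
    using a by (simp add: foundation_def) blast
  with that[of x] show thesis using a(2) mem_subset[of s] by (auto simp: els_def)
qed

lemma infinity:
  obtains b z where "b \<in> M" "z \<in> els s b" "els s z = {}"
    "\<And>x. x \<in> els s b \<Longrightarrow> \<exists>y\<in>els s b. els s y = insert x (els s x)"
proof -
  obtain m where "m \<in> M" using nonempty by blast
  then have "sat M I (\<lambda>_. m) (Defs.infinity s)"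
    by (intro zfc[of _ s]) (auto simp: ZFC_def)
  then obtain b where b: "b \<in> M" "\<exists>z\<in>M. (z, b) \<in> I s \<and> (\<forall>x\<in>M. (x, z) \<notin> I s)"
    "\<forall>x\<in>M. (x, b) \<in> I s \<longrightarrow> (\<exists>y\<in>M. (y, b) \<in> I s \<and> (\<forall>w\<in>M. (w, y) \<in> I s \<longleftrightarrow> (w, x) \<in> I s \<or> w = x))"
    by (simp add: infinity_def) blast
  obtain z where z: "z \<in> els s b" "els s z = {}"
    using b(2) mem_subset[of s] by (auto simp: els_def)
  have "\<exists>y\<in>els s b. els s y = insert x (els s x)" if x: "x \<in> els s b" for x
  proof -
    have "x \<in> M" using x by simp
    with b(3) x obtain y where "y \<in> M" "(y, b) \<in> I s" "\<forall>w\<in>M. (w, y) \<in> I s \<longleftrightarrow> (w, x) \<in> I s \<or> w = x"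
      by (auto simp: els_def)
    then show ?thesis using mem_subset[of s] \<open>x \<in> M\<close> by (intro bexI[of _ y]) (auto simp: els_def)
  qed
  with b(1) z show thesis by (rule that)
qed

text \<open>Brings a definable predicate into the shape that the schemas demand: arguments in
  variables 0 and 1, variables 2, 3 and 4 reserved for those that the schemas add, parameters
  supplied by \<open>e0\<close> from 5 on.\<close>

lemma Dfn_formula:
  assumes "Dfn M (\<lambda>e. P (e 0) (e 1))"
  obtains p e0 where "range e0 \<subseteq> M" "fv p \<inter> {2, 3, 4} = {}"
    "\<forall>e. e 0 \<in> M \<and> e 1 \<in> M \<and> (\<forall>n\<ge>5. e n = e0 n) \<longrightarrow> sat M I e p = P (e 0) (e 1)"
proof -
  obtain p \<rho> where p: "\<forall>n c. \<rho> n = Inr c \<longrightarrow> c \<in> M"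
    "\<And>e. range e \<subseteq> M \<Longrightarrow> sat M I (env \<rho> e) p = P (e 0) (e 1)"
    using assms unfolding Dfn_def by blast
  obtain m where m: "m \<in> M" using nonempty by blast
  \<comment> \<open>All arguments but 0 go to variable 1, which is sound since \<open>P\<close>
    reads only arguments 0 and 1. In \<open>e0\<close>, \<open>m\<close> fills the positions without
    a parameter.\<close>
  define \<sigma> where "\<sigma> n = (case \<rho> n of Inl k \<Rightarrow> (if k = 0 then 0 else 1) | Inr c \<Rightarrow> n + 5)" for n
  define e0 where "e0 n = (case \<rho> (n - 5) of Inl k \<Rightarrow> m | Inr c \<Rightarrow> c)" for n
  obtain p' where p': "fv p' \<subseteq> \<sigma> ` fv p" "\<And>e. sat M I e p' = sat M I (e \<circ> \<sigma>) p"
    using ex_rename by blast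
  show thesis
  proof
    show "range e0 \<subseteq> M" using p(1) m by (auto simp: e0_def split: sum.split)
    show "fv p' \<inter> {2, 3, 4} = {}" using p'(1) by (auto simp: \<sigma>_def split: sum.splits if_splits)
    show "\<forall>e. e 0 \<in> M \<and> e 1 \<in> M \<and> (\<forall>n\<ge>5. e n = e0 n) \<longrightarrow> sat M I e p' = P (e 0) (e 1)"
    proof (intro allI impI; elim conjE)
      fix e assume e: "e 0 \<in> M" "e 1 \<in> M" "\<forall>n\<ge>5. e n = e0 n"
      have "e \<circ> \<sigma> = env \<rho> (\<lambda>k. if k = 0 then e 0 else e 1)"
        by (rule ext) (auto simp: env_def \<sigma>_def e(3) e0_def split: sum.split)
      then show "sat M I e p' \<longleftrightarrow> P (e 0) (e 1)"
        using p(2)[of "\<lambda>k. if k = 0 then e 0 else e 1"] e(1,2) by (auto simp: p'(2))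
    qed
  qed
qed

lemma small_sep:
  assumes "Dfn M (\<lambda>e. P (e 0))" and "small s A"
  shows "small s {x \<in> A. P x}"
proof -
  obtain a where a: "a \<in> M" "els s a = A" using assms(2) by (auto simp: small_def)
  obtain p e0 where p: "range e0 \<subseteq> M" "fv p \<inter> {2, 3, 4} = {}"
    "\<forall>e. e 0 \<in> M \<and> e 1 \<in> M \<and> (\<forall>n\<ge>5. e n = e0 n) \<longrightarrow> sat M I e p = P (e 0)"
    by (rule Dfn_formula[of "\<lambda>x y. P x", OF assms(1)])
  have "Forall 2 (Exists 3 (Forall 0 (Iff (Mem s 0 3) (Conj (Mem s 0 2) p)))) \<in> separation s"
    unfolding separation_def using p(2)
    by (intro CollectI exI[of _ 2] exI[of _ 3] exI[of _ 0] exI[of _ p]) auto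
  then have "sat M I e0 (Forall 2 (Exists 3 (Forall 0 (Iff (Mem s 0 3) (Conj (Mem s 0 2) p)))))"
    by (intro zfc[of _ s]) (use p(1) in \<open>auto simp: ZFC_def\<close>)
  then obtain b where b: "b \<in> M"
    "\<forall>x\<in>M. (x, b) \<in> I s \<longleftrightarrow> (x, a) \<in> I s \<and> sat M I (e0(2 := a, 3 := b, 0 := x)) p"
    using a(1) by (auto simp del: fun_upd_apply) (auto simp: fun_upd_def)
  have "sat M I (e0(2 := a, 3 := b, 0 := x)) p \<longleftrightarrow> P x" if "x \<in> M" for x
    using p(3)[rule_format, of "e0(2 := a, 3 := b, 0 := x)"] p(1) that by auto
  then show ?thesis using b a els_subset[of s a]
    by (intro smallI[of b]) (auto simp: els_def)
qed

lemma small_repl: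
  assumes "Dfn M (\<lambda>e. P (e 0) (e 1))" and "small s A"
    and fn: "\<And>x y y'. x \<in> A \<Longrightarrow> y \<in> M \<Longrightarrow> y' \<in> M \<Longrightarrow> P x y \<Longrightarrow> P x y' \<Longrightarrow> y = y'"
  shows "small s {y \<in> M. \<exists>x\<in>A. P x y}"
proof -
  obtain a where a: "a \<in> M" "els s a = A" using assms(2) by (auto simp: small_def)
  obtain p e0 where p: "range e0 \<subseteq> M" "fv p \<inter> {2, 3, 4} = {}"
    "\<forall>e. e 0 \<in> M \<and> e 1 \<in> M \<and> (\<forall>n\<ge>5. e n = e0 n) \<longrightarrow> sat M I e p = P (e 0) (e 1)"
    by (rule Dfn_formula[OF assms(1)])
  define q where "q = Forall 2 (Imp
    (Forall 0 (Imp (Mem s 0 2) (Exists 4 (Forall 1 (Imp p (Eq 1 4))))))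
    (Exists 3 (Forall 1 (Iff (Mem s 1 3) (Exists 0 (Conj (Mem s 0 2) p))))))"
  have "q \<in> replacement s"
    unfolding replacement_def q_def using p(2)
    by (intro CollectI exI[of _ 2] exI[of _ 3] exI[of _ 0] exI[of _ 1] exI[of _ 4] exI[of _ p]) auto
  then have q: "sat M I e0 q"
    by (intro zfc[of _ s]) (use p(1) in \<open>auto simp: ZFC_def\<close>)
  have P1: "sat M I (e0(2 := a, 0 := x, 4 := z, Suc 0 := y)) p \<longleftrightarrow> P x y" if "x \<in> M" "y \<in> M" for x y z
    using p(3)[rule_format, of "e0(2 := a, 0 := x, 4 := z, Suc 0 := y)"] that by auto
  have P2: "sat M I (e0(2 := a, 3 := b, Suc 0 := y, 0 := x)) p \<longleftrightarrow> P x y" if "x \<in> M" "y \<in> M" for x y b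
    using p(3)[rule_format, of "e0(2 := a, 3 := b, Suc 0 := y, 0 := x)"] that by auto
  have "\<exists>z\<in>M. \<forall>y\<in>M. P x y \<longrightarrow> y = z" if "x \<in> A" for x
  proof (cases "\<exists>z\<in>M. P x z")
    case True
    then show ?thesis using fn[OF that] by blast
  next
    case False
    then show ?thesis using nonempty by blast
  qed
  then have "\<forall>x\<in>M. (x, a) \<in> I s \<longrightarrow> (\<exists>z\<in>M. \<forall>y\<in>M. P x y \<longrightarrow> y = z)"
    using a(2) by (auto simp: els_def)
  then have "\<exists>b\<in>M. \<forall>y\<in>M. (y, b) \<in> I s \<longleftrightarrow> (\<exists>x\<in>M. (x, a) \<in> I s \<and> P x y)"
    using q[unfolded q_def sat.simps, rule_format, OF a(1)]
    by (simp add: P1 P2)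
  then obtain b where b: "b \<in> M" "\<forall>y\<in>M. (y, b) \<in> I s \<longleftrightarrow> (\<exists>x\<in>M. (x, a) \<in> I s \<and> P x y)"
    by blast
  then show ?thesis using a els_subset[of s a]
    by (intro smallI[of b]) (auto simp: els_def)
qed

text \<open>Replacement turns the family into the set of codes of its members, each code being
  unique by extensionality; the union axiom does the rest.\<close>

lemma small_UN:
  assumes P: "Dfn M (\<lambda>e. P (e 0) (e 1))" and A: "small s A"
    and B: "\<And>x. x \<in> A \<Longrightarrow> small s {y \<in> M. P x y}"
  shows "small s {y \<in> M. \<exists>x\<in>A. P x y}"
proof -
  let ?C = "{v \<in> M. \<exists>x\<in>A. els s v = {y \<in> M. P x y}}"
  have "small s ?C"
  proof (rule small_repl[OF _ A])
    have "Dfn M (\<lambda>e. P (e (Suc 0)) (e 0))"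
      using Dfn_rename[OF P, of "\<lambda>n. if n = 0 then 1 else 0"] by simp
    from Dfn_rename[OF P, of "\<lambda>n. if n = 0 then 1 else 0"]
    show "Dfn M (\<lambda>e. els s (e 1) = {y \<in> M. P (e 0) y})"
      by (intro dfn) simp
  qed (metis els_inj)
  then obtain c where c: "c \<in> M" "els s c = ?C" by (auto simp: small_def)
  have "{y \<in> M. \<exists>x\<in>A. P x y} = (\<Union>v\<in>els s c. els s v)"
    unfolding c(2) using B by (fastforce simp: small_def)
  then show ?thesis using small_Union[OF c(1)] by simp
qed

lemma small_Un:
  assumes "small s A" "small s B" shows "small s (A \<union> B)"
proof -
  obtain a b where ab: "a \<in> M" "els s a = A" "b \<in> M" "els s b = B"
    using assms by (auto simp: small_def)
  obtain c where "c \<in> M" "els s c = {a, b}" using small_pair[OF ab(1,3)] by (auto simp: small_def)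
  then show ?thesis using small_Union[of c s] ab by simp
qed

lemma small_insert: "small s A \<Longrightarrow> x \<in> M \<Longrightarrow> small s (insert x A)"
  using small_Un[of s A "{x, x}"] small_pair[of x x s] by simp

text \<open>Otherwise separation would produce Russell's set.\<close>

lemma not_small_M: "\<not> small s M"
proof
  assume "small s M"
  moreover have "Dfn M (\<lambda>e. e 0 \<notin> els s (e 0))" by (intro dfn)
  ultimately have "small s {x \<in> M. x \<notin> els s x}" by (intro small_sep)
  then obtain b where "b \<in> M" "els s b = {x \<in> M. x \<notin> els s x}" by (auto simp: small_def)
  then show False by blast
qed

text \<open>Separation for \<open>s\<close> is applied to a formula that may speak of the other
  relation, \<open>x \<in> els t b\<close>.\<close>

lemma small_subset:
  assumes "b \<in> M" "small s A" "els t b \<subseteq> A" shows "small s (els t b)"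
proof -
  have "small s {x \<in> A. x \<in> els t b}" by (rule small_sep[OF _ assms(2)]) (intro dfn assms)
  moreover have "{x \<in> A. x \<in> els t b} = els t b" using assms(3) by blast
  ultimately show ?thesis by simp
qed

text \<open>By \<open>small_subset\<close> every \<open>s\<close>-subset of \<open>b\<close> is
  coextensive with a \<open>t\<close>-set, so replacement along coextensiveness maps the
  \<open>t\<close>-power set onto the required class. A \<open>t\<close>-subset without an
  \<open>s\<close>-counterpart contributes nothing.\<close>

lemma small_cross_Pow:
  assumes "b \<in> M" "small t (els s b)" shows "small t {w \<in> M. els s w \<subseteq> els s b}"
proof -
  obtain c where c: "c \<in> M" "els t c = els s b" using assms(2) by (auto simp: small_def)
  have "small t {w \<in> M. \<exists>v\<in>{v \<in> M. els t v \<subseteq> els t c}. els s w = els t v}"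
    by (rule small_repl[OF _ small_Pow[OF c(1)]]) ((intro dfn), metis els_inj)
  also have "{w \<in> M. \<exists>v\<in>{v \<in> M. els t v \<subseteq> els t c}. els s w = els t v} = {w \<in> M. els s w \<subseteq> els s b}"
    using c small_subset[of _ t "els s b" s] assms by (auto simp: small_def) metis
  finally show ?thesis .
qed

section \<open>Change of parameters, and terms denoting sets\<close>

lemma Dfn_mono: "Dfn C R \<Longrightarrow> C \<subseteq> D \<Longrightarrow> Dfn D R"
proof -
  assume "Dfn C R" "C \<subseteq> D"
  then obtain p \<rho> where "\<forall>n c. \<rho> n = Inr c \<longrightarrow> c \<in> C"
    "\<forall>e. range e \<subseteq> M \<longrightarrow> sat M I (env \<rho> e) p = R e"
    unfolding Dfn_def by blast
  then show ?thesis
    unfolding Dfn_def using \<open>C \<subseteq> D\<close> by (intro exI[of _ p] exI[of _ \<rho>]) auto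
qed

lemma Trm_mono: "Trm C t \<Longrightarrow> C \<subseteq> D \<Longrightarrow> Trm D t"
  unfolding Trm_def using Dfn_mono by blast

lemma Trm_subst:
  assumes "Trm C (\<lambda>e. g (e 0))" "Trm C t" shows "Trm C (\<lambda>e. g (t e))"
  unfolding Trm_def
proof
  show "\<forall>e. range e \<subseteq> M \<longrightarrow> g (t e) \<in> M"
  proof (intro allI impI)
    fix e :: "nat \<Rightarrow> 'a" assume e: "range e \<subseteq> M"
    then have "range (\<lambda>_::nat. t e) \<subseteq> M" using assms(2) by (auto simp: Trm_def)
    then show "g (t e) \<in> M" using assms(1) unfolding Trm_def by blast
  qed
  have "Dfn C (\<lambda>e. g (e 1) = e 0)" using assms(1) by (simp add: Trm_def)
  then show "Dfn C (\<lambda>e. g (t (\<lambda>n. e (Suc n))) = e 0)"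
    by (rule Dfn_subst2[where P = "\<lambda>x y. g x = y", OF Trm_shift[OF assms(2)] Trm_var])
qed

lemma Trm_M: "Trm C (\<lambda>e. g (e 0)) \<Longrightarrow> x \<in> M \<Longrightarrow> g x \<in> M"
  unfolding Trm_def by (elim conjE allE[of _ "\<lambda>_. x"]) simp

lemma Trm_code:
  assumes "\<And>e. range e \<subseteq> M \<Longrightarrow> small s (A e)"
    and "Dfn C (\<lambda>e. els s (e 0) = A (\<lambda>n. e (Suc n)))"
  shows "Trm C (\<lambda>e. code s (A e))"
  unfolding Trm_def
proof
  show "\<forall>e. range e \<subseteq> M \<longrightarrow> code s (A e) \<in> M" using assms(1) code_M by blast
  show "Dfn C (\<lambda>e. code s (A (\<lambda>n. e (Suc n))) = e 0)"
  proof (rule Dfn_cong[OF _ assms(2)])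
    fix e :: "nat \<Rightarrow> 'a" assume e: "range e \<subseteq> M"
    then have "e 0 \<in> M" "small s (A (\<lambda>n. e (Suc n)))" by (auto intro!: assms(1))
    then show "(code s (A (\<lambda>n. e (Suc n))) = e 0) = (els s (e 0) = A (\<lambda>n. e (Suc n)))"
      using eq_code_iff by metis
  qed
qed

section \<open>Ordered pairs and graphs as elements of the model\<close>

definition upair :: "mem_sym \<Rightarrow> 'a \<Rightarrow> 'a \<Rightarrow> 'a" where
  "upair s x y = code s {x, y}"

text \<open>Kuratowski's pair {{x}, {x, y}}, built with the membership \<open>s\<close>.\<close>

definition pair :: "mem_sym \<Rightarrow> 'a \<Rightarrow> 'a \<Rightarrow> 'a" where
  "pair s x y = upair s (upair s x x) (upair s x y)"

lemma upair_M [simp]: "x \<in> M \<Longrightarrow> y \<in> M \<Longrightarrow> upair s x y \<in> M"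
  unfolding upair_def by (intro code_M small_pair)

lemma pair_M [simp]: "x \<in> M \<Longrightarrow> y \<in> M \<Longrightarrow> pair s x y \<in> M"
  unfolding pair_def by simp

lemma els_upair: "x \<in> M \<Longrightarrow> y \<in> M \<Longrightarrow> els s (upair s x y) = {x, y}"
  unfolding upair_def by (rule els_code[OF small_pair])

lemma upair_eq_iff:
  assumes "x \<in> M" "y \<in> M" "x' \<in> M" "y' \<in> M"
  shows "upair s x y = upair s x' y' \<longleftrightarrow> {x, y} = {x', y'}"
proof
  assume "upair s x y = upair s x' y'"
  then have "els s (upair s x y) = els s (upair s x' y')" by (rule arg_cong)
  then show "{x, y} = {x', y'}" unfolding els_upair[OF assms(1,2)] els_upair[OF assms(3,4)] .
next
  assume "{x, y} = {x', y'}"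
  then show "upair s x y = upair s x' y'" unfolding upair_def by (rule arg_cong)
qed

lemma pair_eq_iff:
  assumes "x \<in> M" "y \<in> M" "x' \<in> M" "y' \<in> M"
  shows "pair s x y = pair s x' y' \<longleftrightarrow> x = x' \<and> y = y'"
  using assms unfolding pair_def by (simp add: upair_eq_iff doubleton_eq_iff) blast

lemma Trm_upair [dfn]:
  assumes "Trm C t" "Trm C u" shows "Trm C (\<lambda>e. upair s (t e) (u e))"
  unfolding upair_def
proof (rule Trm_code)
  show "small s {t e, u e}" if "range e \<subseteq> M" for e
    using assms that by (simp add: Trm_def small_pair)
  have "Dfn C (\<lambda>e. els s (e 0) = {a \<in> M. a = t (\<lambda>n. e (Suc n)) \<or> a = u (\<lambda>n. e (Suc n))})"
    by (intro dfn Trm_shift assms)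
  then show "Dfn C (\<lambda>e. els s (e 0) = {t (\<lambda>n. e (Suc n)), u (\<lambda>n. e (Suc n))})"
  proof (rule Dfn_cong[rotated])
    fix e :: "nat \<Rightarrow> 'a" assume "range e \<subseteq> M"
    then have "range (\<lambda>n. e (Suc n)) \<subseteq> M" by auto
    then have "t (\<lambda>n. e (Suc n)) \<in> M" "u (\<lambda>n. e (Suc n)) \<in> M" using assms by (simp_all add: Trm_def)
    then have "{t (\<lambda>n. e (Suc n)), u (\<lambda>n. e (Suc n))}
      = {a \<in> M. a = t (\<lambda>n. e (Suc n)) \<or> a = u (\<lambda>n. e (Suc n))}" by blast
    then show "(els s (e 0) = {t (\<lambda>n. e (Suc n)), u (\<lambda>n. e (Suc n))})
      = (els s (e 0) = {a \<in> M. a = t (\<lambda>n. e (Suc n)) \<or> a = u (\<lambda>n. e (Suc n))})" by simp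
  qed
qed

lemma Trm_pair [dfn]: "Trm C t \<Longrightarrow> Trm C u \<Longrightarrow> Trm C (\<lambda>e. pair s (t e) (u e))"
  unfolding pair_def by (intro dfn)

text \<open>Replacement sends \<open>x\<close> to the pair of \<open>x\<close> and its value. Points
  of \<open>A\<close> without a value drop out, so \<open>P\<close> may be partial.\<close>

lemma ex_graph:
  assumes P: "Dfn M (\<lambda>e. P (e 0) (e 1))" and A: "small s A"
    and fn: "\<And>x y y'. x \<in> A \<Longrightarrow> y \<in> M \<Longrightarrow> y' \<in> M \<Longrightarrow> P x y \<Longrightarrow> P x y' \<Longrightarrow> y = y'"
  obtains f where "f \<in> M"
    "\<And>x y. x \<in> M \<Longrightarrow> y \<in> M \<Longrightarrow> pair s x y \<in> els s f \<longleftrightarrow> x \<in> A \<and> P x y"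
proof -
  have "small s {p \<in> M. \<exists>x\<in>A. \<exists>y\<in>M. P x y \<and> p = pair s x y}" (is "small s ?B")
  proof (rule small_repl[OF _ A])
    show "Dfn M (\<lambda>e. \<exists>y\<in>M. P (e 0) y \<and> e 1 = pair s (e 0) y)"
      by (intro dfn) (use Dfn_rename[OF P, of "\<lambda>n. if n = 0 then 1 else 0"] in simp)
  qed (use fn in blast)
  then obtain f where f: "f \<in> M" "els s f = ?B" by (auto simp: small_def)
  have "pair s x y \<in> els s f \<longleftrightarrow> x \<in> A \<and> P x y" if "x \<in> M" "y \<in> M" for x y
    unfolding f(2) using that small_subset_M[OF A] by (auto simp: pair_eq_iff)
  with f(1) show thesis by (rule that)
qed

subsection \<open>Recursion on membership\<close>

definition is_trans :: "mem_sym \<Rightarrow> 'a \<Rightarrow> bool" where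
  "is_trans s d \<longleftrightarrow> (\<forall>u\<in>els s d. els s u \<subseteq> els s d)"

lemma Dfn_is_trans [dfn]: "Trm C t \<Longrightarrow> Dfn C (\<lambda>e. is_trans s (t e))"
  unfolding is_trans_def by (intro dfn Trm_shift)

text \<open>Here \<open>f\<close> codes a partial solution of F u = h {F t | t \<in> u} on the
  transitive set \<open>d\<close>. The function \<open>h\<close> sees only the set \<open>w\<close>
  of earlier values, whose existence is part of the requirement; pairs of \<open>f\<close> with
  first component outside \<open>d\<close> are ignored.\<close>

definition approx :: "mem_sym \<Rightarrow> ('a \<Rightarrow> 'a) \<Rightarrow> 'a \<Rightarrow> 'a \<Rightarrow> bool" where
  "approx s h d f \<longleftrightarrow> is_trans s d \<and> (\<forall>u\<in>els s d. \<exists>v\<in>M. pair s u v \<in> els s f) \<and>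
     (\<forall>u\<in>els s d. \<forall>v\<in>M. pair s u v \<in> els s f \<longrightarrow>
        (\<exists>w\<in>M. els s w = {y \<in> M. \<exists>t\<in>els s u. pair s t y \<in> els s f} \<and> v = h w))"

definition recg :: "mem_sym \<Rightarrow> ('a \<Rightarrow> 'a) \<Rightarrow> 'a \<Rightarrow> 'a \<Rightarrow> bool" where
  "recg s h u v \<longleftrightarrow> (\<exists>d\<in>M. \<exists>f\<in>M. approx s h d f \<and> u \<in> els s d \<and> pair s u v \<in> els s f)"

lemma Dfn_recg [dfn]:
  assumes h: "Trm C (\<lambda>e. h (e 0))" and "Trm C t" "Trm C u"
  shows "Dfn C (\<lambda>e. recg s h (t e) (u e))"
  unfolding recg_def approx_def by (intro dfn Trm_shift assms Trm_subst[OF h])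

lemma approx_step:
  assumes "approx s h d f" "u \<in> els s d" "v \<in> M" "pair s u v \<in> els s f"
  obtains w where "w \<in> M" "els s w = {y \<in> M. \<exists>t\<in>els s u. pair s t y \<in> els s f}" "v = h w"
  using assms unfolding approx_def by blast

lemma approx_total: "approx s h d f \<Longrightarrow> u \<in> els s d \<Longrightarrow> \<exists>v\<in>M. pair s u v \<in> els s f"
  unfolding approx_def by blast

lemma approx_trans: "approx s h d f \<Longrightarrow> u \<in> els s d \<Longrightarrow> t \<in> els s u \<Longrightarrow> t \<in> els s d"
  unfolding approx_def is_trans_def by blast

text \<open>The points of disagreement form an \<open>s\<close>-set, so foundation gives a minimal
  one. Below it the values agree, hence \<open>h\<close> receives the same set from both
  sides.\<close>

lemma approx_agree:
  assumes M: "d \<in> M" "f \<in> M" "d' \<in> M" "f' \<in> M"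
    and a: "approx s h d f" and a': "approx s h d' f'"
    and u: "u \<in> els s d" "u \<in> els s d'" and v: "v \<in> M" "v' \<in> M"
    and p: "pair s u v \<in> els s f" "pair s u v' \<in> els s f'"
  shows "v = v'"
proof (rule ccontr)
  assume ne: "v \<noteq> v'"
  define B where "B = {u \<in> els s d. u \<in> els s d' \<and>
    (\<exists>v\<in>M. \<exists>v'\<in>M. pair s u v \<in> els s f \<and> pair s u v' \<in> els s f' \<and> v \<noteq> v')}"
  have "small s B"
    unfolding B_def by (rule small_sep) (intro dfn M small_els)+
  moreover have "B \<noteq> {}" unfolding B_def using ne u v p by blast
  ultimately obtain x where x: "x \<in> B" "els s x \<inter> B = {}" by (rule foundation)
  obtain v v' where xv: "x \<in> els s d" "x \<in> els s d'" "v \<in> M" "v' \<in> M" "pair s x v \<in> els s f"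
    "pair s x v' \<in> els s f'" "v \<noteq> v'" using x(1) unfolding B_def by blast
  have eq: "y = y'" if "t \<in> els s x" "y \<in> M" "y' \<in> M" "pair s t y \<in> els s f" "pair s t y' \<in> els s f'" for t y y'
  proof (rule ccontr)
    assume "y \<noteq> y'"
    moreover have "t \<in> els s d" "t \<in> els s d'"
      using approx_trans a a' xv(1,2) that(1) by metis+
    ultimately have "t \<in> B" unfolding B_def using that by blast
    then show False using x(2) that(1) by blast
  qed
  have "{y \<in> M. \<exists>t\<in>els s x. pair s t y \<in> els s f} = {y \<in> M. \<exists>t\<in>els s x. pair s t y \<in> els s f'}"
    using eq approx_total[OF a approx_trans[OF a xv(1)]] approx_total[OF a' approx_trans[OF a' xv(2)]]
    by (intro Collect_cong) metis
  moreover obtain w where w: "w \<in> M" "els s w = {y \<in> M. \<exists>t\<in>els s x. pair s t y \<in> els s f}" "v = h w"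
    by (rule approx_step[OF a xv(1,3,5)])
  moreover obtain w' where w': "w' \<in> M" "els s w' = {y \<in> M. \<exists>t\<in>els s x. pair s t y \<in> els s f'}" "v' = h w'"
    by (rule approx_step[OF a' xv(2,4,6)])
  ultimately have "w = w'" using els_inj[OF w(1) w'(1), of s] by simp
  then show False using w(3) w'(3) xv(7) by simp
qed

lemma recg_unique: "recg s h u v \<Longrightarrow> recg s h u v' \<Longrightarrow> v \<in> M \<Longrightarrow> v' \<in> M \<Longrightarrow> v = v'"
  unfolding recg_def using approx_agree by blast

text \<open>By uniqueness, one approximation reaching \<open>u\<close> already holds all values of
  \<open>recg\<close> on the elements of \<open>u\<close>, so its recursion equation passes to
  \<open>recg\<close>.\<close>

lemma recg_step:
  assumes "recg s h u v" "u \<in> M" "v \<in> M"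
  shows "\<forall>t\<in>els s u. \<exists>y\<in>M. recg s h t y" "small s {y \<in> M. \<exists>t\<in>els s u. recg s h t y}"
    "v = h (code s {y \<in> M. \<exists>t\<in>els s u. recg s h t y})"
proof -
  obtain d f where df: "d \<in> M" "f \<in> M" "approx s h d f" "u \<in> els s d" "pair s u v \<in> els s f"
    using assms(1) unfolding recg_def by blast
  have iff: "recg s h t y \<longleftrightarrow> pair s t y \<in> els s f" if "t \<in> els s u" "y \<in> M" for t y
  proof
    have t: "t \<in> els s d" using approx_trans df that by blast
    show "recg s h t y" if "pair s t y \<in> els s f"
      unfolding recg_def using that t df by blast
    assume r: "recg s h t y"
    obtain y' where y': "y' \<in> M" "pair s t y' \<in> els s f" using approx_total df t by blast
    then have "recg s h t y'" unfolding recg_def using t df by blast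
    then have "y = y'" using recg_unique r \<open>y \<in> M\<close> y' by blast
    then show "pair s t y \<in> els s f" using y' by simp
  qed
  show "\<forall>t\<in>els s u. \<exists>y\<in>M. recg s h t y"
    using iff approx_total[OF df(3)] approx_trans[OF df(3,4)] by metis
  obtain w where w: "w \<in> M" "els s w = {y \<in> M. \<exists>t\<in>els s u. pair s t y \<in> els s f}" "v = h w"
    by (rule approx_step[OF df(3,4) assms(3) df(5)])
  moreover have eq: "{y \<in> M. \<exists>t\<in>els s u. recg s h t y} = {y \<in> M. \<exists>t\<in>els s u. pair s t y \<in> els s f}"
    using iff by auto
  ultimately show s: "small s {y \<in> M. \<exists>t\<in>els s u. recg s h t y}" unfolding small_def by metis
  have "w = code s {y \<in> M. \<exists>t\<in>els s u. recg s h t y}"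
    using eq_code_iff[OF s w(1)] w(2) eq by simp
  then show "v = h (code s {y \<in> M. \<exists>t\<in>els s u. recg s h t y})" using w(3) by simp
qed

text \<open>A minimal \<open>x\<close> in \<open>T\<close> without a value receives one when the
  pair of \<open>x\<close> and \<open>h w\<close> is added to the values of \<open>recg\<close> on
  \<open>T\<close>. The ambient transitive set is a hypothesis because the existence of transitive
  closures is itself derived from this lemma.\<close>

lemma recg_exists:
  assumes h: "Trm M (\<lambda>e. h (e 0))" and T: "T \<in> M" "is_trans s T" and u: "u \<in> els s T"
  shows "\<exists>v\<in>M. recg s h u v"
proof (rule ccontr)
  assume "\<not> ?thesis"
  then have "u \<in> {u \<in> els s T. \<not> (\<exists>v\<in>M. recg s h u v)}" (is "u \<in> ?B") using u by blast
  moreover have "small s ?B"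
    by (rule small_sep) (intro dfn h small_els T)+
  ultimately obtain x where x: "x \<in> ?B" "els s x \<inter> ?B = {}" using foundation[of s ?B] by blast
  have xM: "x \<in> M" and xT: "x \<in> els s T" and nx: "\<And>v. v \<in> M \<Longrightarrow> \<not> recg s h x v" using x(1) by auto
  have sub: "\<And>t. t \<in> els s x \<Longrightarrow> t \<in> els s T \<and> (\<exists>v\<in>M. recg s h t v)"
    using x(2) T(2) xT unfolding is_trans_def by blast
  let ?R = "{y \<in> M. \<exists>t\<in>els s x. recg s h t y}"
  have R: "small s ?R"
  proof (rule small_repl)
    show "Dfn M (\<lambda>e. recg s h (e 0) (e 1))" by (intro dfn h)
  qed (use recg_unique xM in auto)
  define w where "w = code s ?R"
  have w: "w \<in> M" "els s w = ?R" unfolding w_def using R code_M els_code by auto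
  have hw: "h w \<in> M" using Trm_M[OF h w(1)] .
  \<comment> \<open>The new domain takes all points of \<open>T\<close> that have a value, and
    \<open>x\<close>; \<open>recg_step\<close> makes it transitive.\<close>
  let ?A = "{t \<in> els s T. (\<exists>v\<in>M. recg s h t v) \<or> t = x}"
  have A: "small s ?A"
    by (rule small_sep) (intro dfn h small_els T xM)+
  then obtain d where d: "d \<in> M" "els s d = ?A" by (auto simp: small_def)
  obtain f where f: "f \<in> M" "\<And>t y. t \<in> M \<Longrightarrow> y \<in> M \<Longrightarrow>
    pair s t y \<in> els s f \<longleftrightarrow> t \<in> ?A \<and> (recg s h t y \<or> t = x \<and> y = h w)"
  proof (rule ex_graph[OF _ A, of "\<lambda>t y. recg s h t y \<or> t = x \<and> y = h w"])
    show "Dfn M (\<lambda>e. recg s h (e 0) (e 1) \<or> e 0 = x \<and> e 1 = h w)"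
      by (intro dfn h xM hw)
    show "y = y'" if "y \<in> M" "y' \<in> M" "recg s h t y \<or> t = x \<and> y = h w"
      "recg s h t y' \<or> t = x \<and> y' = h w" for t y y'
      using that nx recg_unique by blast
  qed (rule that)
  \<comment> \<open>The added pair is invisible from \<open>z\<close> when \<open>x\<close> is not
    an element of \<open>z\<close>.\<close>
  have fw: "{y \<in> M. \<exists>t\<in>els s z. pair s t y \<in> els s f} = {y \<in> M. \<exists>t\<in>els s z. recg s h t y}"
    if "els s z \<subseteq> ?A" "x \<notin> els s z" for z
  proof -
    have "pair s t y \<in> els s f \<longleftrightarrow> recg s h t y" if "t \<in> els s z" "y \<in> M" for t y
      using f(2)[of t y] that \<open>els s z \<subseteq> ?A\<close> \<open>x \<notin> els s z\<close> by auto
    then show ?thesis by blast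
  qed
  have nxx: "x \<notin> els s x" using sub nx by blast
  have step: "x \<notin> els s t \<and> els s t \<subseteq> ?A" if tA: "t \<in> ?A" for t
  proof (cases "t = x")
    case True
    then show ?thesis using nxx sub by blast
  next
    case False
    then obtain v where "v \<in> M" "recg s h t v" using tA by blast
    moreover have "t \<in> M" using tA els_M by blast
    ultimately have "\<forall>z\<in>els s t. \<exists>y\<in>M. recg s h z y" using recg_step(1) by blast
    then show ?thesis using tA nx T(2) unfolding is_trans_def by blast
  qed
  have "approx s h d f"
    unfolding approx_def
  proof (intro conjI ballI impI)
    show "is_trans s d" unfolding is_trans_def d(2) using step by blast
    fix t assume "t \<in> els s d"
    then have t: "t \<in> ?A" "t \<in> M" using d(2) els_M by blast+
    then show "\<exists>v\<in>M. pair s t v \<in> els s f"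
      using f(2) hw by blast
    fix v assume v: "v \<in> M" "pair s t v \<in> els s f"
    have fwt: "{y \<in> M. \<exists>z\<in>els s t. pair s z y \<in> els s f} = {y \<in> M. \<exists>z\<in>els s t. recg s h z y}"
      using step[OF t(1)] by (intro fw) auto
    show "\<exists>w\<in>M. els s w = {y \<in> M. \<exists>z\<in>els s t. pair s z y \<in> els s f} \<and> v = h w"
    proof (cases "t = x")
      case True
      then have "v = h w" using v f(2) t nx by blast
      then show ?thesis using w True fwt by metis
    next
      case False
      then have r: "recg s h t v" using f(2) t v by blast
      note rs = recg_step(2,3)[OF r t(2) v(1)]
      show ?thesis unfolding fwt using rs(2) code_M[OF rs(1)] els_code[OF rs(1)] by blast
    qed
  qed
  moreover have "x \<in> els s d" using d(2) xT by simp
  moreover have "pair s x (h w) \<in> els s f" using f(2)[OF xM hw] xT by simp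
  ultimately have "recg s h x (h w)" unfolding recg_def using d f(1) by blast
  then show False using nx hw by blast
qed

section \<open>Transitive closure and membership induction\<close>

text \<open>The transitive closure is itself obtained by recursion on membership, over a transitive set of
  natural numbers, where the recursion theorem is already available.\<close>

lemma ex_trans:
  assumes x: "x \<in> M" obtains T where "T \<in> M" "is_trans s T" "x \<in> els s T"
proof -
  \<comment> \<open>With \<open>w\<close> the set of earlier values, the recursion reads F n = x
    \<union> \<Union>{\<Union>(F m) | m \<in> n}.\<close>
  define A where "A w = {z \<in> M. z \<in> els s x \<or> (\<exists>y\<in>els s w. \<exists>v\<in>els s y. z \<in> els s v)}" for w
  have A_iff: "z \<in> A w \<longleftrightarrow> z \<in> M \<and> (z \<in> els s x \<or> (\<exists>y\<in>els s w. \<exists>v\<in>els s y. z \<in> els s v))" for z w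
    by (simp add: A_def)
  have A: "small s (A w)" if w: "w \<in> M" for w
  proof -
    obtain b where b: "b \<in> M" "els s b = (\<Union>y\<in>els s w. els s y)"
      using small_Union[OF w, of s] by (auto simp: small_def)
    have "A w = els s x \<union> (\<Union>v\<in>els s b. els s v)" unfolding A_def b(2) by auto
    then show ?thesis using small_Un[OF small_els[OF x] small_Union[OF b(1)]] by simp
  qed
  have h: "Trm M (\<lambda>e. code s (A (e 0)))"
  proof (rule Trm_code)
    show "Dfn M (\<lambda>e. els s (e 0) = A (e (Suc 0)))" unfolding A_def by (intro dfn x)
  qed (use A in auto)
  let ?r = "recg s (\<lambda>w. code s (A w))"
  obtain b z where b: "b \<in> M" "z \<in> els s b" "els s z = {}"
    "\<And>x. x \<in> els s b \<Longrightarrow> \<exists>y\<in>els s b. els s y = insert x (els s x)" by (rule infinity[of s]) (rule that)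
  \<comment> \<open>The set \<open>b\<close> may have extraneous elements. These conditions cut it
    down to a transitive set of ordinals that still contains the empty set and is closed under
    successor.\<close>
  let ?N = "{n \<in> els s b. els s n \<subseteq> els s b \<and> is_trans s n \<and> (\<forall>m\<in>els s n. is_trans s m)}"
  have "small s ?N" by (rule small_sep) (intro dfn small_els b)+
  then obtain N where N: "N \<in> M" "els s N = ?N" by (auto simp: small_def)
  have z: "z \<in> els s N" using b by (simp add: N is_trans_def)
  have trans_sub: "els s m \<subseteq> els s n" if "is_trans s n" "m \<in> els s n" for m n
    using that unfolding is_trans_def by blast
  have trN: "is_trans s N" unfolding is_trans_def N(2) using trans_sub by blast
  have suc: "\<exists>m\<in>els s N. n \<in> els s m" if n: "n \<in> els s N" for n
  proof -
    have "n \<in> els s b" using n N by blast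
    then obtain m where m: "m \<in> els s b" "els s m = insert n (els s n)" using b(4) by blast
    have nN: "els s n \<subseteq> els s b" "is_trans s n" "\<forall>m\<in>els s n. is_trans s m" using n N by blast+
    have "is_trans s m" unfolding is_trans_def m(2) using trans_sub[OF nN(2)] by blast
    then have "m \<in> els s N" using m n nN N(2) by auto
    then show ?thesis using m(2) by blast
  qed
  have ex: "\<exists>v\<in>M. ?r n v" if "n \<in> els s N" for n
    by (rule recg_exists[OF h N(1) trN that])
  have val: "els s v = A (code s {y \<in> M. \<exists>t\<in>els s n. ?r t y})"
    "els s (code s {y \<in> M. \<exists>t\<in>els s n. ?r t y}) = {y \<in> M. \<exists>t\<in>els s n. ?r t y}"
    if "?r n v" "n \<in> M" "v \<in> M" for n v
  proof -
    note rs = recg_step(2,3)[OF that]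
    show "els s (code s {y \<in> M. \<exists>t\<in>els s n. ?r t y}) = {y \<in> M. \<exists>t\<in>els s n. ?r t y}"
      by (rule els_code[OF rs(1)])
    show "els s v = A (code s {y \<in> M. \<exists>t\<in>els s n. ?r t y})"
      using rs(2) els_code[OF A[OF code_M[OF rs(1)]]] by simp
  qed
  let ?P = "\<lambda>n y. \<exists>v\<in>M. ?r n v \<and> y \<in> els s v"
  have "small s {y \<in> M. \<exists>n\<in>els s N. ?P n y}"
  proof (rule small_UN)
    show "Dfn M (\<lambda>e. ?P (e 0) (e 1))" by (intro dfn h)
    show "small s {y \<in> M. ?P n y}" if n: "n \<in> els s N" for n
    proof -
      obtain v where v: "v \<in> M" "?r n v" using ex[OF n] by blast
      have "{y \<in> M. ?P n y} = els s v"
        using v(1) v(2) recg_unique[OF v(2) _ v(1)] els_M by blast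
      then show ?thesis using v by simp
    qed
  qed (rule small_els[OF N(1)])
  \<comment> \<open>\<open>T\<close> consists of \<open>x\<close> and the elements of all F
    n.\<close>
  from small_insert[OF this x] obtain T where T: "T \<in> M"
    "els s T = insert x {y \<in> M. \<exists>n\<in>els s N. ?P n y}" unfolding small_def by blast
  show thesis
  proof
    show "T \<in> M" "x \<in> els s T" using T by auto
    have xT: "els s x \<subseteq> els s T"
    proof
      fix y assume y: "y \<in> els s x"
      obtain v where v: "v \<in> M" "?r z v" using ex[OF z] by blast
      have "y \<in> els s v" unfolding val(1)[OF v(2) els_M[OF z] v(1)] A_iff using y els_M by blast
      then have "\<exists>n\<in>els s N. ?P n y" using v z by blast
      then show "y \<in> els s T" unfolding T(2) using els_M[OF y] by simp
    qed
    \<comment> \<open>Elements of \<open>y\<close> lie in F m as soon as \<open>n\<close> is an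
      element of \<open>m\<close>; \<open>suc\<close> supplies such an \<open>m\<close> in
      \<open>N\<close>.\<close>
    have sub: "els s y \<subseteq> els s T" if n: "n \<in> els s N" and v: "v \<in> M" "?r n v" and y: "y \<in> els s v" for n v y
    proof
      fix q assume q: "q \<in> els s y"
      obtain m where m: "m \<in> els s N" "n \<in> els s m" using suc[OF n] by blast
      obtain v' where v': "v' \<in> M" "?r m v'" using ex[OF m(1)] by blast
      note val' = val[OF v'(2) els_M[OF m(1)] v'(1)]
      have "q \<in> els s v'"
        unfolding val'(1) A_iff val'(2) using m(2) v y q els_M by blast
      then have "\<exists>n\<in>els s N. ?P n q" using v' m by blast
      then show "q \<in> els s T" unfolding T(2) using els_M[OF q] by simp
    qed
    have "els s y \<subseteq> els s T" if "y \<in> els s T" for y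
    proof (cases "y = x")
      case False
      with that obtain n v where "n \<in> els s N" "v \<in> M" "?r n v" "y \<in> els s v"
        unfolding T(2) by blast
      then show ?thesis by (rule sub)
    qed (simp add: xT)
    then show "is_trans s T" unfolding is_trans_def by blast
  qed
qed

text \<open>Foundation concerns sets only, so the counterexamples are first confined to a transitive
  set containing \<open>x\<close>; transitivity keeps the elements of a minimal one inside
  it.\<close>

lemma mem_induct:
  assumes P: "Dfn M (\<lambda>e. P (e 0))"
    and step: "\<And>x. x \<in> M \<Longrightarrow> (\<And>z. z \<in> els s x \<Longrightarrow> P z) \<Longrightarrow> P x"
    and x: "x \<in> M"
  shows "P x"
proof (rule ccontr)
  assume "\<not> P x"
  obtain T where T: "T \<in> M" "is_trans s T" "x \<in> els s T" by (rule ex_trans[OF x])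
  have "small s {x \<in> els s T. \<not> P x}" by (rule small_sep) (intro dfn P small_els T)+
  moreover have "{x \<in> els s T. \<not> P x} \<noteq> {}" using T \<open>\<not> P x\<close> by blast
  ultimately obtain y where y: "y \<in> {x \<in> els s T. \<not> P x}" "els s y \<inter> {x \<in> els s T. \<not> P x} = {}"
    by (rule foundation)
  have "P y"
  proof (rule step)
    show "y \<in> M" using y(1) els_M by blast
    show "P z" if "z \<in> els s y" for z
      using y T(2) that unfolding is_trans_def by blast
  qed
  then show False using y by blast
qed

section \<open>Recursion as a definable operation on \<open>M\<close>\<close>

definition rec :: "mem_sym \<Rightarrow> ('a \<Rightarrow> 'a) \<Rightarrow> 'a \<Rightarrow> 'a" where
  "rec s h u = (THE v. v \<in> M \<and> recg s h u v)"

lemma recg_iff: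
  assumes h: "Trm M (\<lambda>e. h (e 0))" and u: "u \<in> M"
  shows "rec s h u \<in> M" "v \<in> M \<Longrightarrow> recg s h u v \<longleftrightarrow> rec s h u = v"
proof -
  obtain T where T: "T \<in> M" "is_trans s T" "u \<in> els s T" by (rule ex_trans[OF u])
  have "\<exists>!v. v \<in> M \<and> recg s h u v" using recg_exists[OF h T] recg_unique by blast
  from theI'[OF this, folded rec_def] recg_unique
  show "rec s h u \<in> M" "v \<in> M \<Longrightarrow> recg s h u v \<longleftrightarrow> rec s h u = v" by blast+
qed

lemma
  assumes h: "Trm M (\<lambda>e. h (e 0))" and u: "u \<in> M"
  shows small_rec: "small s (rec s h ` els s u)"
    and rec_eq: "rec s h u = h (code s (rec s h ` els s u))"
proof -
  have "recg s h u (rec s h u)" using recg_iff[OF h u] by blast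
  note * = recg_step(2,3)[OF this u recg_iff(1)[OF h u]]
  moreover have "{y \<in> M. \<exists>t\<in>els s u. recg s h t y} = rec s h ` els s u"
    using recg_iff[OF h] by auto
  ultimately show "small s (rec s h ` els s u)" "rec s h u = h (code s (rec s h ` els s u))" by simp_all
qed

text \<open>The parameter set \<open>C\<close> is preserved, so that a step definable without
  parameters yields a function definable without parameters.\<close>

lemma Trm_rec:
  assumes h: "Trm C (\<lambda>e. h (e 0))" and C: "C \<subseteq> M" and t: "Trm C t"
  shows "Trm C (\<lambda>e. rec s h (t e))"
proof (rule Trm_subst[OF _ t])
  note hM = Trm_mono[OF h C]
  show "Trm C (\<lambda>e. rec s h (e 0))" unfolding Trm_def
  proof
    show "\<forall>e. range e \<subseteq> M \<longrightarrow> rec s h (e 0) \<in> M" using recg_iff(1)[OF hM] by blast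
    have "Dfn C (\<lambda>e. recg s h (e (Suc 0)) (e 0))" by (intro dfn h)
    then show "Dfn C (\<lambda>e. rec s h (e (Suc 0)) = e 0)"
    proof (rule Dfn_cong[rotated])
      fix e :: "nat \<Rightarrow> 'a" assume "range e \<subseteq> M"
      then have "e 0 \<in> M" "e (Suc 0) \<in> M" by auto
      then show "(rec s h (e (Suc 0)) = e 0) = recg s h (e (Suc 0)) (e 0)" using recg_iff(2)[OF hM] by blast
    qed
  qed
qed

subsection \<open>Comparing the two hierarchies\<close>

text \<open>The set \<open>w\<close> collects earlier levels, and \<open>A\<close> is the union of
  their \<open>t\<close>-power sets. That \<open>A\<close> is a \<open>t\<close>-set for the levels
  in question is established only by \<open>good\<close>; until then the default \<open>w\<close>
  keeps the step total.\<close>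

definition lev_step :: "mem_sym \<Rightarrow> mem_sym \<Rightarrow> 'a \<Rightarrow> 'a" where
  "lev_step s t w =
     (let A = {x \<in> M. \<exists>z\<in>els s w. els t x \<subseteq> els t z} in if small t A then code t A else w)"

definition lev :: "mem_sym \<Rightarrow> mem_sym \<Rightarrow> 'a \<Rightarrow> 'a" where
  "lev s t = rec s (lev_step s t)"

text \<open>The intended extension of \<open>lev s t x\<close>, available as a class before it is
  known to be a \<open>t\<close>-set.\<close>

definition stage :: "mem_sym \<Rightarrow> mem_sym \<Rightarrow> 'a \<Rightarrow> 'a set" where
  "stage s t x = {w \<in> M. \<exists>z\<in>els s x. els t w \<subseteq> els t (lev s t z)}"

lemma Trm_lev_step: "Trm M (\<lambda>e. lev_step s t (e 0))"
  unfolding Trm_def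
proof
  show "\<forall>e. range e \<subseteq> M \<longrightarrow> lev_step s t (e 0) \<in> M"
    by (auto simp: lev_step_def Let_def code_M)
  let ?A = "\<lambda>w. {x \<in> M. \<exists>z\<in>els s w. els t x \<subseteq> els t z}"
  have "Dfn M (\<lambda>e. small t (?A (e (Suc 0))) \<and> els t (e 0) = ?A (e (Suc 0)) \<or>
    \<not> small t (?A (e (Suc 0))) \<and> e (Suc 0) = e 0)" by (intro dfn)
  then show "Dfn M (\<lambda>e. lev_step s t (e (Suc 0)) = e 0)"
  proof (rule Dfn_cong[rotated])
    fix e :: "nat \<Rightarrow> 'a" assume "range e \<subseteq> M"
    then have "e 0 \<in> M" by auto
    define A where "A = ?A (e (Suc 0))"
    have "lev_step s t (e (Suc 0)) = (if small t A then code t A else e (Suc 0))"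
      unfolding lev_step_def Let_def A_def ..
    then have "(lev_step s t (e (Suc 0)) = e 0) \<longleftrightarrow>
      small t A \<and> els t (e 0) = A \<or> \<not> small t A \<and> e (Suc 0) = e 0"
      using eq_code_iff[of t A "e 0"] \<open>e 0 \<in> M\<close> by (cases "small t A") auto
    then show "(lev_step s t (e (Suc 0)) = e 0) \<longleftrightarrow>
      small t (?A (e (Suc 0))) \<and> els t (e 0) = ?A (e (Suc 0)) \<or>
      \<not> small t (?A (e (Suc 0))) \<and> e (Suc 0) = e 0" unfolding A_def .
  qed
qed

lemma Trm_lev [dfn]: "Trm M u \<Longrightarrow> Trm M (\<lambda>e. lev s t (u e))"
  unfolding lev_def by (rule Trm_rec[OF Trm_lev_step subset_refl])

lemma lev_M [simp]: "x \<in> M \<Longrightarrow> lev s t x \<in> M"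
  by (rule Trm_M[OF Trm_lev[OF Trm_var]])

lemma Dfn_stage [dfn]:
  assumes "Trm M u" "Trm M v" shows "Dfn M (\<lambda>e. u e \<in> stage s t (v e))"
proof (rule Dfn_cong)
  show "Dfn M (\<lambda>e. \<exists>z\<in>els s (v e). els t (u e) \<subseteq> els t (lev s t z))"
    by (intro dfn Trm_shift assms)
  show "(u e \<in> stage s t (v e)) = (\<exists>z\<in>els s (v e). els t (u e) \<subseteq> els t (lev s t z))"
    if "range e \<subseteq> M" for e
    using assms(1) that by (simp add: stage_def Trm_def)
qed

lemma Dfn_small_stage [dfn]: "Trm M v \<Longrightarrow> Dfn M (\<lambda>e. small t' (stage s t (v e)))"
  unfolding stage_def by (intro dfn Trm_shift)

section \<open>Extensions of the levels\<close>

lemma els_lev: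
  assumes x: "x \<in> M" and st: "small t (stage s t x)"
  shows "els t (lev s t x) = stage s t x"
proof -
  define w where "w = code s (lev s t ` els s x)"
  have w: "els s w = lev s t ` els s x"
    unfolding w_def lev_def by (rule els_code[OF small_rec[OF Trm_lev_step x]])
  have "lev s t x = lev_step s t w"
    using rec_eq[OF Trm_lev_step x, of s s t] unfolding w_def lev_def .
  moreover have "{y \<in> M. \<exists>z\<in>els s w. els t y \<subseteq> els t z} = stage s t x"
    unfolding stage_def w by auto
  ultimately have "lev s t x = code t (stage s t x)"
    using st by (simp add: lev_step_def)
  then show ?thesis using els_code[OF st] by simp
qed

text \<open>For a single relation this is the usual stage V indexed by the rank of \<open>x\<close>;
  it is a set by power set, replacement and union.\<close>

lemma els_lev_self: "x \<in> M \<Longrightarrow> els t (lev t t x) = stage t t x"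
proof (rule els_lev)
  assume x: "x \<in> M"
  show "small t (stage t t x)" unfolding stage_def
    by (rule small_UN) ((intro dfn), rule small_els[OF x], rule small_Pow, simp)
qed

lemma subset_stage: "w \<in> stage s t x \<Longrightarrow> v \<in> M \<Longrightarrow> els t v \<subseteq> els t w \<Longrightarrow> v \<in> stage s t x"
  unfolding stage_def by blast

lemma stageI: "z \<in> els s x \<Longrightarrow> w \<in> M \<Longrightarrow> els t w \<subseteq> els t (lev s t z) \<Longrightarrow> w \<in> stage s t x"
  unfolding stage_def by blast

lemma stageE:
  assumes "w \<in> stage s t x"
  obtains z where "w \<in> M" "z \<in> els s x" "els t w \<subseteq> els t (lev s t z)"
  using assms unfolding stage_def by blast

text \<open>By induction each element of \<open>x\<close> is a subset of its own stage, hence an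
  element of the stage of \<open>x\<close>.\<close>

lemma subset_lev_self:
  assumes "x \<in> M" shows "els t x \<subseteq> els t (lev t t x)"
proof (rule mem_induct[OF _ _ assms, of _ t])
  show "Dfn M (\<lambda>e. els t (e 0) \<subseteq> els t (lev t t (e 0)))" by (intro dfn)
  show "els t x \<subseteq> els t (lev t t x)"
    if x: "x \<in> M" and IH: "\<And>z. z \<in> els t x \<Longrightarrow> els t z \<subseteq> els t (lev t t z)" for x
    unfolding els_lev_self[OF x] using stageI[OF _ els_M IH] by blast
qed

text \<open>The invariant of the induction on \<open>s\<close>. Its aim is the first clause, which
  at \<open>x\<close> follows from the other three at the elements of \<open>x\<close>: the second
  brings in Russell's paradox, the third makes the levels behave like stages of \<open>t\<close>,
  the fourth is a linear comparison of ranks.\<close>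

definition good :: "mem_sym \<Rightarrow> mem_sym \<Rightarrow> 'a \<Rightarrow> bool" where
  "good s t x \<longleftrightarrow> small t (stage s t x) \<and> small s (els t (lev s t x)) \<and>
     (\<forall>w\<in>M. els t w \<subseteq> els t (lev s t x) \<longrightarrow> els t (lev t t w) \<subseteq> els t (lev s t x)) \<and>
     (\<forall>y\<in>M. els t (lev t t y) \<subseteq> els t (lev s t x) \<or> lev s t x \<in> els t (lev t t y))"

lemma Dfn_good: "Dfn M (\<lambda>e. good s t (e 0))"
  unfolding good_def by (intro dfn)

lemma good_step:
  assumes x: "x \<in> M" and IH: "\<And>z. z \<in> els s x \<Longrightarrow> good s t z"
  shows "good s t x"
proof -
  \<comment> \<open>\<open>small_cross_Pow\<close> is used with the relations exchanged: the second
    clause makes the \<open>t\<close>-subsets of each earlier level an \<open>s\<close>-set.\<close>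
  have stage_small: "small s (stage s t x)"
    unfolding stage_def
  proof (rule small_UN[OF _ small_els[OF x]])
    show "Dfn M (\<lambda>e. els t (e 1) \<subseteq> els t (lev s t (e 0)))" by (intro dfn)
    show "small s {w \<in> M. els t w \<subseteq> els t (lev s t z)}" if "z \<in> els s x" for z
      using IH[OF that] els_M[OF that] by (intro small_cross_Pow) (auto simp: good_def)
  qed
  have IH3: "els t (lev t t w) \<subseteq> els t (lev s t z)"
    if "z \<in> els s x" "w \<in> M" "els t w \<subseteq> els t (lev s t z)" for w z
    using IH[OF that(1)] that(2,3) unfolding good_def by blast
  have IH4: "els t (lev t t y) \<subseteq> els t (lev s t z) \<or> lev s t z \<in> els t (lev t t y)"
    if "z \<in> els s x" "y \<in> M" for y z
    using IH[OF that(1)] that(2) unfolding good_def by blast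
  \<comment> \<open>This is the third clause at \<open>x\<close>, phrased for the class
    \<open>stage s t x\<close>, which is not yet known to be a \<open>t\<close>-set.\<close>
  have below: "els t (lev t t y) \<subseteq> stage s t x" if "y \<in> M" "els t y \<subseteq> stage s t x" for y
  proof
    fix u assume "u \<in> els t (lev t t y)"
    then obtain v where v: "u \<in> M" "v \<in> els t y" "els t u \<subseteq> els t (lev t t v)"
      unfolding els_lev_self[OF \<open>y \<in> M\<close>] by (rule stageE)
    from v(2) that(2) have "v \<in> stage s t x" by blast
    then obtain z where z: "v \<in> M" "z \<in> els s x" "els t v \<subseteq> els t (lev s t z)" by (rule stageE)
    have "els t u \<subseteq> els t (lev s t z)" using v(3) IH3[OF z(2,1,3)] by blast
    then show "u \<in> stage s t x" by (rule stageI[OF z(2) v(1)])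
  qed
  have st: "small t (stage s t x)"
  proof (rule ccontr)
    assume ns: "\<not> small t (stage s t x)"
    have "y \<in> stage s t x" if "y \<in> M" for y
    proof (rule mem_induct[OF _ _ that, of _ t])
      show "Dfn M (\<lambda>e. e 0 \<in> stage s t x)" by (intro dfn x)
    next
      fix y assume y: "y \<in> M" "\<And>z. z \<in> els t y \<Longrightarrow> z \<in> stage s t x"
      have sub: "els t (lev t t y) \<subseteq> stage s t x" using y by (intro below) auto
      \<comment> \<open>Not being a \<open>t\<close>-set, the stage differs from
        \<open>lev t t y\<close> and so has an element \<open>v\<close> outside it. Comparison then
        puts \<open>lev t t y\<close>, and with it \<open>y\<close>, inside a single earlier
        level.\<close>
      have "els t (lev t t y) \<noteq> stage s t x" using ns small_els[OF lev_M[OF y(1)], of t] by metis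
      with sub obtain v where v: "v \<in> stage s t x" "v \<notin> els t (lev t t y)" by blast
      obtain z where z: "v \<in> M" "z \<in> els s x" "els t v \<subseteq> els t (lev s t z)" using v(1) by (rule stageE)
      have "lev s t z \<notin> els t (lev t t y)"
        using v(2) subset_stage[OF _ z(1,3)] unfolding els_lev_self[OF y(1)] by blast
      with IH4[OF z(2) y(1)] have l: "els t (lev t t y) \<subseteq> els t (lev s t z)" by blast
      have "els t y \<subseteq> els t (lev t t y)" by (rule subset_lev_self[OF y(1)])
      with l show "y \<in> stage s t x" by (intro stageI[OF z(2) y(1)]) blast
    qed
    then have "stage s t x = M" unfolding stage_def by blast
    then show False using stage_small not_small_M by simp
  qed
  note el = els_lev[OF x st]
  have "els t (lev t t y) \<subseteq> stage s t x \<or> lev s t x \<in> els t (lev t t y)" if y: "y \<in> M" for y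
  proof (cases "els t (lev t t y) \<subseteq> stage s t x")
    case False
    then obtain u where u: "u \<in> els t (lev t t y)" "u \<notin> stage s t x" by blast
    from u(1) obtain v where v: "u \<in> M" "v \<in> els t y" "els t u \<subseteq> els t (lev t t v)"
      unfolding els_lev_self[OF y] by (rule stageE)
    have vM: "v \<in> M" using v(2) by (rule els_M)
    \<comment> \<open>Because of \<open>u\<close>, no earlier level \<open>lev s t z\<close>
      includes \<open>lev t t v\<close>; by comparison each of them is an element of
      \<open>lev t t v\<close>.\<close>
    have "stage s t x \<subseteq> els t (lev t t v)"
    proof
      fix a assume "a \<in> stage s t x"
      then obtain z where z: "a \<in> M" "z \<in> els s x" "els t a \<subseteq> els t (lev s t z)" by (rule stageE)
      have "\<not> els t (lev t t v) \<subseteq> els t (lev s t z)"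
        using v(3) u(2) stageI[OF z(2) v(1)] by blast
      with IH4[OF z(2) vM] have "lev s t z \<in> els t (lev t t v)" by blast
      then show "a \<in> els t (lev t t v)"
        unfolding els_lev_self[OF vM] using z(1,3) by (rule subset_stage)
    qed
    then have "lev s t x \<in> stage t t y" using v(2) x by (intro stageI[of v]) (simp_all add: el)
    then show ?thesis unfolding els_lev_self[OF y] by blast
  qed simp
  then show ?thesis unfolding good_def el using st stage_small below by blast
qed

lemma good: "x \<in> M \<Longrightarrow> good s t x"
  by (rule mem_induct[OF Dfn_good good_step])

section \<open>Every set of one relation is a set of the other\<close>

lemma els_lev_stage: "x \<in> M \<Longrightarrow> els t (lev s t x) = stage s t x"
  using good[of x s t] by (intro els_lev) (auto simp: good_def)

text \<open>Both inclusions express that the \<open>s\<close>-rank of \<open>z\<close> is at most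
  that of \<open>z'\<close>. Consequently \<open>lev s t z\<close> determines
  \<open>lev s s z\<close>, as \<open>small_lev_self\<close> requires. With \<open>z'\<close>
  quantified inside, the induction hypothesis at \<open>y\<close> can be applied to an element
  \<open>y'\<close> of \<open>z'\<close>.\<close>

lemma lev_mono:
  assumes "z \<in> M"
  shows "\<forall>z'\<in>M. els t (lev s t z) \<subseteq> els t (lev s t z') \<longrightarrow> els s (lev s s z) \<subseteq> els s (lev s s z')"
proof (rule mem_induct[OF _ _ assms, of _ s])
  show "Dfn M (\<lambda>e. \<forall>z'\<in>M. els t (lev s t (e 0)) \<subseteq> els t (lev s t z') \<longrightarrow>
    els s (lev s s (e 0)) \<subseteq> els s (lev s s z'))" by (intro dfn)
next
  fix z assume z: "z \<in> M" and IH: "\<And>y. y \<in> els s z \<Longrightarrow>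
    \<forall>z'\<in>M. els t (lev s t y) \<subseteq> els t (lev s t z') \<longrightarrow> els s (lev s s y) \<subseteq> els s (lev s s z')"
  show "\<forall>z'\<in>M. els t (lev s t z) \<subseteq> els t (lev s t z') \<longrightarrow> els s (lev s s z) \<subseteq> els s (lev s s z')"
  proof (intro ballI impI subsetI)
    fix z' u assume z': "z' \<in> M" and sub: "els t (lev s t z) \<subseteq> els t (lev s t z')"
      and "u \<in> els s (lev s s z)"
    from this(3) obtain y where y: "u \<in> M" "y \<in> els s z" "els s u \<subseteq> els s (lev s s y)"
      unfolding els_lev_self[OF z] by (rule stageE)
    have "lev s t y \<in> stage s t z" using y(2) by (intro stageI[of y]) (simp_all add: els_M[OF y(2)])
    then have "lev s t y \<in> stage s t z'" using sub unfolding els_lev_stage[OF z] els_lev_stage[OF z'] by blast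
    then obtain y' where y': "y' \<in> els s z'" "els t (lev s t y) \<subseteq> els t (lev s t y')" by (rule stageE)
    then have "els s (lev s s y) \<subseteq> els s (lev s s y')" using IH[OF y(2)] els_M[OF y'(1)] by blast
    then show "u \<in> els s (lev s s z')"
      unfolding els_lev_self[OF z'] using y y' by (intro stageI[OF y'(1)]) auto
  qed
qed

text \<open>The stage of \<open>x\<close> is a union of \<open>s\<close>-power sets of earlier
  stages, each of them a \<open>t\<close>-set by the induction hypothesis and
  \<open>small_cross_Pow\<close>.\<close>

lemma small_lev_self:
  assumes "x \<in> M" shows "small t (els s (lev s s x))"
proof (rule mem_induct[OF _ _ assms, of _ s])
  show "Dfn M (\<lambda>e. small t (els s (lev s s (e 0))))" by (intro dfn)
next
  fix x assume x: "x \<in> M" and IH: "\<And>z. z \<in> els s x \<Longrightarrow> small t (els s (lev s s z))"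
  \<comment> \<open>Since \<open>x\<close> is not yet known to be coextensive with a
    \<open>t\<close>-set, the union is indexed by the levels \<open>lev s t z\<close>, which
    separation for \<open>t\<close> cuts out of \<open>lev s t x\<close>.\<close>
  let ?A = "{g \<in> els t (lev s t x). \<exists>z\<in>els s x. g = lev s t z}"
  let ?P = "\<lambda>g u. \<exists>z\<in>els s x. g = lev s t z \<and> els s u \<subseteq> els s (lev s s z)"
  have "small t {u \<in> M. \<exists>g\<in>?A. ?P g u}"
  proof (rule small_UN)
    show "Dfn M (\<lambda>e. ?P (e 0) (e 1))" by (intro dfn x)
    show "small t ?A"
    proof (rule small_sep)
      show "Dfn M (\<lambda>e. \<exists>z\<in>els s x. e 0 = lev s t z)" by (intro dfn x)
    qed (simp add: x)
    fix g assume "g \<in> ?A"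
    then obtain z where z: "z \<in> els s x" "g = lev s t z" by blast
    have zM: "z \<in> M" using z(1) by (rule els_M)
    \<comment> \<open>Several elements of \<open>x\<close> may share the level \<open>g\<close>; by
      \<open>lev_mono\<close> they share the \<open>s\<close>-stage as well.\<close>
    have "els s (lev s s z') \<subseteq> els s (lev s s z)" if "z' \<in> els s x" "g = lev s t z'" for z'
      using lev_mono[OF els_M[OF that(1)], of t s] zM that(2) z(2) by auto
    then have "{u \<in> M. ?P g u} = {u \<in> M. els s u \<subseteq> els s (lev s s z)}"
      using z by blast
    then show "small t {u \<in> M. ?P g u}"
      using small_cross_Pow[OF lev_M[OF zM] IH[OF z(1)]] by simp
  qed
  also have "{u \<in> M. \<exists>g\<in>?A. ?P g u} = stage s s x"
  proof -
    have "lev s t z \<in> els t (lev s t x)" if "z \<in> els s x" for z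
      unfolding els_lev_stage[OF x] using that by (intro stageI[of z]) (simp_all add: els_M[OF that])
    then show ?thesis unfolding stage_def by blast
  qed
  finally show "small t (els s (lev s s x))" unfolding els_lev_self[OF x] .
qed

text \<open>Separation for \<open>t\<close> cuts \<open>x\<close> out of its \<open>s\<close>-stage,
  which is already a \<open>t\<close>-set.\<close>

lemma small_els_any: "x \<in> M \<Longrightarrow> small t (els s x)"
  by (rule small_subset[OF _ small_lev_self subset_lev_self])

subsection \<open>The isomorphism\<close>

text \<open>Recursion along \<open>s\<close> delivers the earlier values as an \<open>s\<close>-set
  \<open>w\<close>; recoding it as the coextensive \<open>t\<close>-set gives the equation of
  \<open>els_transfer\<close>.\<close>

definition transfer :: "mem_sym \<Rightarrow> mem_sym \<Rightarrow> 'a \<Rightarrow> 'a" where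
  "transfer s t = rec s (\<lambda>w. code t (els s w))"

lemma Trm_transfer_step: "Trm C (\<lambda>e. code t (els s (e 0)))"
  by (rule Trm_code) (auto intro: dfn small_els_any)

lemma Trm_transfer [dfn]: "C \<subseteq> M \<Longrightarrow> Trm C u \<Longrightarrow> Trm C (\<lambda>e. transfer s t (u e))"
  unfolding transfer_def by (rule Trm_rec[OF Trm_transfer_step])

lemma transfer_M: "x \<in> M \<Longrightarrow> transfer s t x \<in> M"
  by (rule Trm_M[OF Trm_transfer[OF subset_refl Trm_var]])

lemma els_transfer:
  assumes x: "x \<in> M" shows "els t (transfer s t x) = transfer s t ` els s x"
proof -
  have sm: "small s (transfer s t ` els s x)"
    unfolding transfer_def by (rule small_rec[OF Trm_transfer_step x])
  have "transfer s t x = code t (els s (code s (transfer s t ` els s x)))"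
    using rec_eq[OF Trm_transfer_step x, of s t s] unfolding transfer_def .
  then show ?thesis
    using els_code[OF small_els_any[OF code_M[OF sm], of t s]] els_code[OF sm] by simp
qed

text \<open>Induction on \<open>s\<close> with extensionality for \<open>s\<close>. As
  \<open>s\<close> and \<open>t\<close> are arbitrary, the two transfers are inverse to each other
  on both sides.\<close>

lemma transfer_inverse:
  assumes "x \<in> M" shows "transfer t s (transfer s t x) = x"
proof (rule mem_induct[OF _ _ assms, of _ s])
  show "Dfn M (\<lambda>e. transfer t s (transfer s t (e 0)) = e 0)" by (intro dfn subset_refl)
next
  fix x assume x: "x \<in> M" and IH: "\<And>z. z \<in> els s x \<Longrightarrow> transfer t s (transfer s t z) = z"
  have "els s (transfer t s (transfer s t x)) = (\<lambda>z. transfer t s (transfer s t z)) ` els s x"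
    by (simp add: els_transfer transfer_M x image_image)
  also have "\<dots> = els s x" using IH by simp
  finally show "transfer t s (transfer s t x) = x"
    using x by (intro els_inj) (simp_all add: transfer_M)
qed

lemma transfer_isomorphism: "is_isomorphism M (I s) M (I t) (transfer s t)"
  unfolding is_isomorphism_def
proof (intro conjI ballI)
  show "bij_betw (transfer s t) M M"
    by (rule bij_betw_byWitness[of _ "transfer t s"]) (auto simp: transfer_inverse transfer_M)
  fix x y assume xy: "x \<in> M" "y \<in> M"
  have "x \<in> els s y \<longleftrightarrow> transfer s t x \<in> transfer s t ` els s y"
  proof
    assume "transfer s t x \<in> transfer s t ` els s y"
    then obtain z where z: "z \<in> els s y" "transfer s t x = transfer s t z" by blast
    have "x = z"
      using arg_cong[OF z(2), of "transfer t s"]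
      unfolding transfer_inverse[OF xy(1)] transfer_inverse[OF els_M[OF z(1)]] .
    then show "x \<in> els s y" using z(1) by simp
  qed (rule imageI)
  also have "\<dots> \<longleftrightarrow> transfer s t x \<in> els t (transfer s t y)" using els_transfer xy by simp
  finally show "(x, y) \<in> I s \<longleftrightarrow> (transfer s t x, transfer s t y) \<in> I t" by (simp add: els_def)
qed

lemma Dfn_empty_formula:
  assumes "Dfn {} (\<lambda>e. P (e 0) (e 1))"
  obtains p where "fv p \<subseteq> {0, 1}" "\<forall>e. range e \<subseteq> M \<longrightarrow> sat M I e p = P (e 0) (e 1)"
proof -
  obtain p \<rho> where p: "\<forall>n c. \<rho> n \<noteq> Inr c"
    "\<forall>e. range e \<subseteq> M \<longrightarrow> sat M I (env \<rho> e) p = P (e 0) (e 1)"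
    using assms unfolding Dfn_def by blast
  \<comment> \<open>Without parameters every variable stands for an argument. All those not standing
    for argument 1 are merged into variable 0, which is harmless as \<open>P\<close> reads only
    arguments 0 and 1.\<close>
  define \<sigma> :: "nat \<Rightarrow> nat" where "\<sigma> n = (if \<rho> n = Inl 1 then 1 else 0)" for n
  obtain q where q: "fv q \<subseteq> \<sigma> ` fv p" "\<forall>e. sat M I e q = sat M I (e \<circ> \<sigma>) p"
    using ex_rename by blast
  have "sat M I e q = P (e 0) (e 1)" if e: "range e \<subseteq> M" for e
  proof -
    define e' where "e' n = (if n = 1 then e 1 else e 0)" for n :: nat
    have "e \<circ> \<sigma> = env \<rho> e'"
    proof
      fix n
      obtain k where "\<rho> n = Inl k" using p(1) by (cases "\<rho> n") auto
      then show "(e \<circ> \<sigma>) n = env \<rho> e' n" by (simp add: env_def \<sigma>_def e'_def)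
    qed
    moreover have "range e' \<subseteq> M" using e by (auto simp: e'_def)
    ultimately show ?thesis using p(2) q(2) by (simp add: e'_def)
  qed
  moreover have "fv q \<subseteq> {0, 1}" using q(1) by (auto simp: \<sigma>_def)
  ultimately show thesis by (intro that) auto
qed

lemma transfer_definable: "\<exists>p. fv p \<subseteq> {0, 1} \<and>
  (\<forall>e. range e \<subseteq> M \<longrightarrow> (sat M I e p \<longleftrightarrow> transfer s t (e 0) = e 1))"
proof -
  \<comment> \<open>Neither the recoding step nor the recursion introduces a parameter, so
    \<open>C\<close> can be empty.\<close>
  have "Dfn {} (\<lambda>e. transfer s t (e 0) = e 1)" by (intro dfn empty_subsetI)
  then show ?thesis by (rule Dfn_empty_formula) blast
qed

end

theorem theorem1:
  fixes M :: "'a set" and E1 E2 :: "('a \<times> 'a) set"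
  assumes "E1 \<subseteq> M \<times> M" and "E2 \<subseteq> M \<times> M"
    and "models M E1 E2 (ZFC In1 \<union> ZFC In2)"
  shows "\<exists>f. is_isomorphism M E1 M E2 f \<and> definable_function M E1 E2 f"
proof -
  interpret bi_zf M "interp E1 E2"
  proof
    show "M \<noteq> {}" using assms(3) by (simp add: models_def)
    show "interp E1 E2 s \<subseteq> M \<times> M" for s using assms(1,2) by (cases s) auto
    show "sat M (interp E1 E2) e p" if "p \<in> ZFC s" "range e \<subseteq> M" for p s e
      using assms(3) that by (cases s) (auto simp: models_def)
  qed
  have "is_isomorphism M E1 M E2 (transfer In1 In2)"
    using transfer_isomorphism[of In1 In2] by simp
  moreover have "definable_function M E1 E2 (transfer In1 In2)"
    unfolding definable_function_def using transfer_definable transfer_M by blast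
  ultimately show ?thesis by blast
qed

end
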